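(* Let $X$ be an infinite-dimensional real Banach space and let $\mathcal D$ be a fundamental sub-semigroup of $\mathcal C(X)$. Then there is a Banach space $C(K)$ for some compact Hausdorff space $K$ (namely the one fixed in the context together with the map $\mathbb T:\mathcal B(X)\to C(K)^+$) such that for every convex measure $\mu$ of non-property $\mathfrak D$ with respect to $\mathcal D$ on $X$ there is a function $F=F_{\mathcal D}$ on the cone $V=\mathbb T(\mathcal B(X))\subset C(K)^+$ satisfying: (i) $\mu(B)=F(\mathbb T B)$ for all $B\in\mathcal B(X)$; (ii) $F$ is nonnegative, convex and monotone (i.e. $f\le g$ in $V$ implies $F(f)\le F(g)$) on $V$; (iii) for all $r\ge0$, $F$ is bounded by $b_r=F(r\,\mathbb T B_X)$ on $V\cap(rB_{C(K)})$; (iv) for all $r\ge0$, $F$ is $c_r$-Lipschitzian on $V\cap(rB_{C(K)})$, where $c_r=F\big((1+r)\mathbb T B_X\big)=\mu\big((1+r)B_X\big)$; (v) in particular, if $\mu$ is a sublinear measure of non-property $\mathfrak D$, then one can take $c_r=\mu(B_X)$ in (iv).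
   Context: $X$ is an infinite-dimensional real Banach space with closed unit ball $B_X$; $B_{C(K)}$ is the closed unit ball of $C(K)$. $\mathcal B(X)$ is the set of nonempty bounded subsets of $X$, $\mathcal C(X)$ the set of nonempty closed bounded convex subsets (with addition $A\oplus B=\overline{A+B}$, scalar multiplication of sets, and the Hausdorff metric), $\mathcal K(X)$ the set of nonempty compact convex subsets. $\Omega=B_{X^*}$ carries the norm topology and $C_b(\Omega)$ is the space of bounded continuous real functions on $\Omega$ with the sup-norm and pointwise order. For $B\in\mathcal B(X)$ let $J(B)\in C_b(\Omega)$, $J(B)(x^* )=\sup_{b\in B}\langle x^*,b\rangle$ (so $J(B)=J(\overline{\rm co}(B))$). Put $E_{\mathcal C}=\overline{J\mathcal C(X)-J\mathcal C(X)}$ and $E_{\mathcal K}=\overline{J\mathcal K(X)-J\mathcal K(X)}$ (closures in $C_b(\Omega)$). It is known that $E_{\mathcal C}$ is a Banach lattice, $E_{\mathcal K}$ is a lattice ideal of it, and $E_{\mathcal C}/E_{\mathcal K}$ is an abstract $M$ space, so there are a compact Hausdorff space $K$ and a linear order isometry $T$ from $E_{\mathcal C}/E_{\mathcal K}$ onto a sublattice of $C(K)$; fix such $K$ and $T$. Let $Q:E_{\mathcal C}\to E_{\mathcal C}/E_{\mathcal K}$ be the quotient map and $\mathbb T=TQJ:\mathcal B(X)\to C(K)^+$ (its values lie in the positive cone $C(K)^+$). $V=\mathbb T(\mathcal B(X))=\mathbb T(\mathcal C(X))$, a closed cone. A fundamental sub-semigroup of $\mathcal C(X)$ is a subset $\mathcal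 D\subset\mathcal C(X)$, closed in the Hausdorff metric and closed under $\oplus$ and scalar multiplication, such that: $\bigcup\{D\in\mathcal D\}=X$; $A,B\in\mathcal D$ entails $\overline{\rm co}(\pm A\cup\pm B)\in\mathcal D$, where $\pm A\cup\pm B=A\cup(-A)\cup B\cup(-B)$; and $\emptyset\ne B\subset D\in\mathcal D$ implies $\overline{\rm co}(B)\in\mathcal D$. A convex measure of non-property $\mathfrak D$ (with respect to $\mathcal D$) on $X$ is a function $\mu:\mathcal B(X)\to[0,\infty)$ such that for all $A,B\in\mathcal B(X)$: (1) $\mu(B)=0$ iff $\overline{\rm co}(B)\in\mathcal D$; (2) $A\supset B$ implies $\mu(A)\ge\mu(B)$; (3) $\mu({\rm co}(B))=\mu(B)$; (4) $\mu(\lambda A+(1-\lambda)B)\le\lambda\mu(A)+(1-\lambda)\mu(B)$ for $0\le\lambda\le1$. A sublinear measure of non-property $\mathfrak D$ is a function satisfying (1), (2), (3) together with $\mu(A+B)\le\mu(A)+\mu(B)$ and $\mu(kB)=k\mu(B)$ for all $k\ge0$.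
   Formalization: Since $E_{\mathcal K}$ is not a lattice ideal of $E_{\mathcal C}$ for infinite-dimensional $X$, existence of $K$ and $T$ is proved for the quotient by the closed lattice ideal generated by $E_{\mathcal K}$; (i)–(v) are proved for any such $K,T$ for this ideal, and also for $E_{\mathcal K}$ itself. *)

theory Defs
  imports "HOL-Analysis.Analysis"
begin

section \<open>Families of sets\<close>

definition bounded_sets :: "'a::real_normed_vector set set" where
  "bounded_sets = {B. B \<noteq> {} \<and> bounded B}"

definition closed_bounded_convex_sets :: "'a::real_normed_vector set set" where
  "closed_bounded_convex_sets = {C. C \<noteq> {} \<and> closed C \<and> bounded C \<and> convex C}"

definition compact_convex_sets :: "'a::real_normed_vector set set" where
  "compact_convex_sets = {C. C \<noteq> {} \<and> compact C \<and> convex C}"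

abbreviation closed_hull :: "'a::real_normed_vector set \<Rightarrow> 'a set" where
  "closed_hull B \<equiv> closure (convex hull B)"

abbreviation scale_set :: "real \<Rightarrow> 'a::real_normed_vector set \<Rightarrow> 'a set" (infixr "\<cdot>" 75) where
  "c \<cdot> A \<equiv> (\<lambda>x. c *\<^sub>R x) ` A"

definition hausdorff_dist :: "'a::metric_space set \<Rightarrow> 'a set \<Rightarrow> real" where
  "hausdorff_dist A B = max (SUP a\<in>A. infdist a B) (SUP b\<in>B. infdist b A)"

text \<open>Sums of sets are the Minkowski sums \<open>A + B = {a + b | a \<in> A, b \<in> B}\<close> of
  \<open>HOL-Library.Set_Algebras\<close>.\<close>

definition fundamental_subsemigroup :: "'a::real_normed_vector set set \<Rightarrow> bool" where
  "fundamental_subsemigroup \<D> \<longleftrightarrow>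
     \<D> \<subseteq> closed_bounded_convex_sets \<and>
     (\<forall>A\<in>closed_bounded_convex_sets.
        (\<forall>e>0. \<exists>D\<in>\<D>. hausdorff_dist A D < e) \<longrightarrow> A \<in> \<D>) \<and>
     (\<forall>A\<in>\<D>. \<forall>B\<in>\<D>. closure (A + B) \<in> \<D>) \<and>
     (\<forall>A\<in>\<D>. \<forall>c::real. c \<cdot> A \<in> \<D>) \<and>
     \<Union>\<D> = UNIV \<and>
     (\<forall>A\<in>\<D>. \<forall>B\<in>\<D>. closed_hull (A \<union> uminus ` A \<union> B \<union> uminus ` B) \<in> \<D>) \<and>
     (\<forall>D\<in>\<D>. \<forall>B. B \<noteq> {} \<and> B \<subseteq> D \<longrightarrow> closed_hull B \<in> \<D>)"


section \<open>Measures of non-property \<open>\<DD>\<close>\<close>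

text \<open>A measure is a function on \<^const>\<open>bounded_sets\<close>; its values elsewhere are irrelevant.\<close>

definition nonproperty_measure :: "'a::real_normed_vector set set \<Rightarrow> ('a set \<Rightarrow> real) \<Rightarrow> bool" where
  "nonproperty_measure \<D> \<mu> \<longleftrightarrow>
     (\<forall>B\<in>bounded_sets. 0 \<le> \<mu> B) \<and>
     (\<forall>B\<in>bounded_sets. \<mu> B = 0 \<longleftrightarrow> closed_hull B \<in> \<D>) \<and>
     (\<forall>A\<in>bounded_sets. \<forall>B\<in>bounded_sets. B \<subseteq> A \<longrightarrow> \<mu> B \<le> \<mu> A) \<and>
     (\<forall>B\<in>bounded_sets. \<mu> (convex hull B) = \<mu> B)"

definition convex_measure :: "'a::real_normed_vector set set \<Rightarrow> ('a set \<Rightarrow> real) \<Rightarrow> bool" where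
  "convex_measure \<D> \<mu> \<longleftrightarrow>
     nonproperty_measure \<D> \<mu> \<and>
     (\<forall>A\<in>bounded_sets. \<forall>B\<in>bounded_sets. \<forall>t. 0 \<le> t \<and> t \<le> 1 \<longrightarrow>
        \<mu> (t \<cdot> A + (1 - t) \<cdot> B) \<le> t * \<mu> A + (1 - t) * \<mu> B)"

definition sublinear_measure :: "'a::real_normed_vector set set \<Rightarrow> ('a set \<Rightarrow> real) \<Rightarrow> bool" where
  "sublinear_measure \<D> \<mu> \<longleftrightarrow>
     nonproperty_measure \<D> \<mu> \<and>
     (\<forall>A\<in>bounded_sets. \<forall>B\<in>bounded_sets. \<mu> (A + B) \<le> \<mu> A + \<mu> B) \<and>
     (\<forall>B\<in>bounded_sets. \<forall>k\<ge>0. \<mu> (k \<cdot> B) = k * \<mu> B)"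

lemma sublinear_imp_convex_measure:
  assumes "sublinear_measure \<D> \<mu>"
  shows "convex_measure \<D> \<mu>"
proof -
  have "\<mu> (t \<cdot> A + (1 - t) \<cdot> B) \<le> t * \<mu> A + (1 - t) * \<mu> B"
    if "A \<in> bounded_sets" "B \<in> bounded_sets" "0 \<le> t" "t \<le> 1" for A B t
  proof -
    have "t \<cdot> A \<in> bounded_sets" "(1 - t) \<cdot> B \<in> bounded_sets"
      using that by (auto simp: bounded_sets_def bounded_scaling)
    then have "\<mu> (t \<cdot> A + (1 - t) \<cdot> B) \<le> \<mu> (t \<cdot> A) + \<mu> ((1 - t) \<cdot> B)"
      using assms unfolding sublinear_measure_def by blast
    then show ?thesis
      using assms that unfolding sublinear_measure_def by auto
  qed
  then show ?thesis
    using assms unfolding convex_measure_def sublinear_measure_def by blast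
qed


section \<open>The space \<open>C\<^sub>b(\<Omega>)\<close> and the support map \<open>J\<close>\<close>

text \<open>The closed unit ball \<open>\<Omega>\<close> of the dual, with the norm topology.\<close>

typedef (overloaded) 'a dual_ball = "cball (0 :: 'a::real_normed_vector \<Rightarrow>\<^sub>L real) 1"
  morphisms functional Abs_dual_ball
  by (rule exI[of _ 0]) simp

instantiation dual_ball :: (real_normed_vector) metric_space
begin

definition dist_dual_ball :: "'a dual_ball \<Rightarrow> 'a dual_ball \<Rightarrow> real" where
  "dist_dual_ball \<omega> \<eta> = dist (functional \<omega>) (functional \<eta>)"

definition uniformity_dual_ball :: "('a dual_ball \<times> 'a dual_ball) filter" where
  "uniformity_dual_ball = (INF e\<in>{0 <..}. principal {(x, y). dist x y < e})"

definition open_dual_ball :: "'a dual_ball set \<Rightarrow> bool" where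
  "open_dual_ball U = (\<forall>x\<in>U. \<forall>\<^sub>F (x', y) in uniformity. x' = x \<longrightarrow> y \<in> U)"

instance
proof
  fix x y z :: "'a dual_ball"
  show "dist x y = 0 \<longleftrightarrow> x = y"
    by (simp add: dist_dual_ball_def functional_inject)
  show "dist x y \<le> dist x z + dist y z"
    by (simp add: dist_dual_ball_def dist_triangle2)
qed (simp_all add: uniformity_dual_ball_def open_dual_ball_def)

end

definition J :: "'a::real_normed_vector set \<Rightarrow> ('a dual_ball \<Rightarrow>\<^sub>C real)" where
  "J B = Bcontfun (\<lambda>\<omega>. SUP b\<in>B. blinfun_apply (functional \<omega>) b)"

lemma functional_diff_le:
  assumes "norm b \<le> M"
  shows "blinfun_apply (functional \<omega>) b \<le> blinfun_apply (functional \<eta>) b + dist \<omega> \<eta> * M"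
proof -
  have "blinfun_apply (functional \<omega>) b - blinfun_apply (functional \<eta>) b
      = blinfun_apply (functional \<omega> - functional \<eta>) b"
    by (simp add: blinfun.diff_left)
  also have "\<dots> \<le> norm (functional \<omega> - functional \<eta>) * norm b"
    using norm_blinfun[of "functional \<omega> - functional \<eta>" b] by simp
  also have "\<dots> \<le> dist \<omega> \<eta> * M"
    using assms by (simp add: dist_dual_ball_def dist_norm mult_left_mono)
  finally show ?thesis by simp
qed

lemma functional_abs_le:
  assumes "norm b \<le> M"
  shows "\<bar>blinfun_apply (functional \<omega>) b\<bar> \<le> M"
proof -
  have "\<bar>blinfun_apply (functional \<omega>) b\<bar> \<le> norm (functional \<omega>) * norm b"
    using norm_blinfun[of "functional \<omega>" b] by simp
  also have "\<dots> \<le> 1 * norm b"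
    using functional[of \<omega>] by (intro mult_right_mono) auto
  finally show ?thesis using assms by simp
qed

lemma J_apply:
  assumes "B \<in> bounded_sets"
  shows "apply_bcontfun (J B) \<omega> = (SUP b\<in>B. blinfun_apply (functional \<omega>) b)"
proof -
  let ?s = "\<lambda>\<omega>. SUP b\<in>B. blinfun_apply (functional \<omega>) b"
  obtain M where M: "M > 0" "\<And>b. b \<in> B \<Longrightarrow> norm b \<le> M" and ne: "B \<noteq> {}"
    using assms by (auto simp: bounded_sets_def bounded_pos)
  have bdd: "bdd_above ((\<lambda>b. blinfun_apply (functional \<omega>) b) ` B)" for \<omega>
    by (intro bdd_aboveI2[where M = M] abs_le_D1[OF functional_abs_le[OF M(2)]])
  have le: "?s \<omega> \<le> ?s \<eta> + dist \<omega> \<eta> * M" for \<omega> \<eta>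
  proof (rule cSUP_least[OF ne])
    fix b assume "b \<in> B"
    then show "blinfun_apply (functional \<omega>) b \<le> ?s \<eta> + dist \<omega> \<eta> * M"
      using functional_diff_le[OF M(2), of b \<omega> \<eta>] cSUP_upper[OF _ bdd, of b \<eta>] by force
  qed
  have "dist (?s \<omega>) (?s \<eta>) \<le> M * dist \<omega> \<eta>" for \<omega> \<eta>
    using le[of \<omega> \<eta>] le[of \<eta> \<omega>] by (auto simp: dist_real_def dist_commute mult.commute)
  then have "M-lipschitz_on UNIV ?s"
    using M(1) by (auto simp: lipschitz_on_def)
  then have cont: "continuous_on UNIV ?s"
    by (rule lipschitz_on_continuous_on)
  have "\<bar>?s \<omega>\<bar> \<le> M" for \<omega>
  proof -
    obtain b where b: "b \<in> B" using ne by blast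
    have "?s \<omega> \<le> M"
      by (intro cSUP_least[OF ne] abs_le_D1[OF functional_abs_le[OF M(2)]])
    moreover have "- M \<le> ?s \<omega>"
      using functional_abs_le[OF M(2)[OF b], of \<omega>] cSUP_upper[OF b bdd, of \<omega>] by linarith
    ultimately show ?thesis by simp
  qed
  then have "bounded (range ?s)"
    by (auto simp: bounded_iff)
  with cont have "?s \<in> bcontfun"
    by (simp add: bcontfun_def)
  then show ?thesis
    by (simp add: J_def Bcontfun_inverse)
qed

definition E_space :: "'a::real_normed_vector set set \<Rightarrow> ('a dual_ball \<Rightarrow>\<^sub>C real) set" where
  "E_space \<S> = closure {J A - J B | A B. A \<in> \<S> \<and> B \<in> \<S>}"

abbreviation E\<^sub>C :: "('a::real_normed_vector dual_ball \<Rightarrow>\<^sub>C real) set" where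
  "E\<^sub>C \<equiv> E_space closed_bounded_convex_sets"

abbreviation E\<^sub>K :: "('a::real_normed_vector dual_ball \<Rightarrow>\<^sub>C real) set" where
  "E\<^sub>K \<equiv> E_space compact_convex_sets"

definition lattice_ideal :: "('a::real_normed_vector dual_ball \<Rightarrow>\<^sub>C real) set \<Rightarrow> bool" where
  "lattice_ideal N \<longleftrightarrow>
     subspace N \<and> N \<subseteq> E\<^sub>C \<and>
     (\<forall>u\<in>E\<^sub>C. \<forall>v\<in>N. (\<forall>\<omega>. \<bar>apply_bcontfun u \<omega>\<bar> \<le> \<bar>apply_bcontfun v \<omega>\<bar>) \<longrightarrow> u \<in> N)"

text \<open>The closed lattice ideal of \<open>E\<^sub>C\<close> generated by \<open>E\<^sub>K\<close>; it is \<open>E\<^sub>K\<close> itself whenever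
  \<open>E\<^sub>K\<close> is an ideal. That is not automatic: the elements of \<open>E\<^sub>K\<close> are weak* continuous on
  \<open>\<Omega>\<close>, but in \<open>\<ell>\<^sub>2\<close>, with \<open>y\<close> denoting \<open>x\<close> with the first coordinate deleted,
  \<open>u(x) = max \<bar>x\<^sub>1\<bar> \<parallel>y\<parallel> - \<parallel>y\<parallel>\<close> defines an element of \<open>E\<^sub>C\<close> with \<open>0 \<le> u \<le> \<bar>x\<^sub>1\<bar> \<in> E\<^sub>K\<close> that is
  not weakly continuous.\<close>

definition E\<^sub>K_ideal :: "('a::real_normed_vector dual_ball \<Rightarrow>\<^sub>C real) set" where
  "E\<^sub>K_ideal = (\<lambda>N. closed N \<and> lattice_ideal N) hull E\<^sub>K"


section \<open>Quotients of \<open>E\<^sub>C\<close>\<close>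

text \<open>Elements of \<open>E\<^sub>C/N\<close> are the cosets \<open>u +o N\<close>, with the quotient norm and the quotient
  order.\<close>

definition quotient_space ::
    "('a::real_normed_vector dual_ball \<Rightarrow>\<^sub>C real) set \<Rightarrow> ('a dual_ball \<Rightarrow>\<^sub>C real) set set" where
  "quotient_space N = (\<lambda>u. u +o N) ` E\<^sub>C"

definition coset_norm :: "('a::real_normed_vector dual_ball \<Rightarrow>\<^sub>C real) set \<Rightarrow> real" where
  "coset_norm U = (INF u\<in>U. norm u)"

definition coset_le ::
    "('a::real_normed_vector dual_ball \<Rightarrow>\<^sub>C real) set \<Rightarrow> ('a dual_ball \<Rightarrow>\<^sub>C real) set \<Rightarrow> bool" where
  "coset_le U V \<longleftrightarrow> (\<exists>u\<in>U. \<exists>v\<in>V. \<forall>\<omega>. apply_bcontfun u \<omega> \<le> apply_bcontfun v \<omega>)"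


section \<open>\<open>C(K)\<close> and the map \<open>TQJ\<close>\<close>

text \<open>Functions on the space \<open>K\<close> are normalised to be \<open>0\<close> outside \<open>topspace K\<close>, so that
  equal elements of \<open>C(K)\<close> are equal as HOL functions. The order is the pointwise one.\<close>

definition C_space :: "'k topology \<Rightarrow> ('k \<Rightarrow> real) set" where
  "C_space K = {f. continuous_map K euclideanreal f \<and> (\<forall>x. x \<notin> topspace K \<longrightarrow> f x = 0)}"

text \<open>The inserted \<open>0\<close> only matters if \<open>topspace K\<close> is empty.\<close>

definition C_norm :: "'k topology \<Rightarrow> ('k \<Rightarrow> real) \<Rightarrow> real" where
  "C_norm K f = Sup (insert 0 ((\<lambda>x. \<bar>f x\<bar>) ` topspace K))"

definition order_isometry_into_C ::
    "('a::real_normed_vector dual_ball \<Rightarrow>\<^sub>C real) set \<Rightarrow> 'k topology \<Rightarrow>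
     (('a dual_ball \<Rightarrow>\<^sub>C real) set \<Rightarrow> ('k \<Rightarrow> real)) \<Rightarrow> bool" where
  "order_isometry_into_C N K T \<longleftrightarrow>
     T ` quotient_space N \<subseteq> C_space K \<and>
     (\<forall>u\<in>E\<^sub>C. \<forall>v\<in>E\<^sub>C. T ((u + v) +o N) = (\<lambda>x. T (u +o N) x + T (v +o N) x)) \<and>
     (\<forall>u\<in>E\<^sub>C. \<forall>c::real. T ((c *\<^sub>R u) +o N) = (\<lambda>x. c * T (u +o N) x)) \<and>
     (\<forall>U\<in>quotient_space N. C_norm K (T U) = coset_norm U) \<and>
     (\<forall>U\<in>quotient_space N. \<forall>V\<in>quotient_space N. coset_le U V \<longleftrightarrow> T U \<le> T V) \<and>
     (\<forall>f\<in>T ` quotient_space N. \<forall>g\<in>T ` quotient_space N.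
        sup f g \<in> T ` quotient_space N \<and> inf f g \<in> T ` quotient_space N)"

definition TQJ ::
    "('a::real_normed_vector dual_ball \<Rightarrow>\<^sub>C real) set \<Rightarrow>
     (('a dual_ball \<Rightarrow>\<^sub>C real) set \<Rightarrow> ('k \<Rightarrow> real)) \<Rightarrow> 'a set \<Rightarrow> ('k \<Rightarrow> real)" where
  "TQJ N T B = T (J B +o N)"

definition cone_in_C_pos :: "'k topology \<Rightarrow> ('k \<Rightarrow> real) set \<Rightarrow> bool" where
  "cone_in_C_pos K V \<longleftrightarrow>
     V \<subseteq> {f \<in> C_space K. \<forall>x. 0 \<le> f x} \<and>
     (\<forall>f\<in>V. \<forall>g\<in>V. (\<lambda>x. f x + g x) \<in> V) \<and>
     (\<forall>f\<in>V. \<forall>c\<ge>0. (\<lambda>x. c * f x) \<in> V)"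

end

theory Submission
  imports Defs
begin

text \<open>By Hahn--Banach, an inequality \<open>J A \<le> J B + n\<close> with \<open>n\<close> vanishing in the quotient says that
  \<open>A\<close> lies in the closed convex hull of \<open>B + F + \<delta> B\<^sub>X\<close>, for every \<open>\<delta> > 0\<close> and some finite set
  \<open>F\<close>. Finite sets have measure \<open>0\<close>, so convexity yields \<open>\<mu> A \<le> \<mu> B\<close>. Hence \<open>\<mu>\<close> factors through a
  monotone convex function on the cone of the sets \<open>TQJ B\<close>; since the norm of a quotient class is a
  bound by multiples of \<open>J B\<^sub>X\<close>, the bounds and the Lipschitz constants come from convexity along
  the direction of \<open>B\<^sub>X\<close>.

  All elements of \<open>E\<^sub>C\<close> are positively homogeneous, so \<open>J B\<^sub>X\<close> is an order unit. The compact space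
  \<open>K\<close> consists of the contractive lattice homomorphisms on \<open>C\<^sub>b(\<Omega>)\<close> that annihilate the ideal;
  there are enough of them because evaluations at suitable points of the unit sphere cluster.\<close>


section \<open>The Hahn--Banach theorem\<close>

text \<open>Two obstacles shape the argument. A convex measure need be neither subadditive nor
  homogeneous: \<open>\<mu> (B + F)\<close> does not split into \<open>\<mu> B\<close> and
  \<open>\<mu> F\<close>, and \<open>\<mu> (2 \<cdot> B)\<close> may exceed twice
  \<open>\<mu> B\<close>. So the finite summand is given a weight tending to 0. It then has to be
  multiplied by the inverse of that weight, which is harmless exactly because a finite set stays
  finite and keeps measure 0. The other obstacle is that norm estimates in the quotient are
  estimates by constants on \<Omega>, while nonzero constants are not homogeneous and so lie outside
  \<open>E\<^sub>C\<close>. The support function of the unit ball is 1 on the unit sphere and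
  replaces them there; homogeneity carries the comparison to all of \<Omega>. Separation must
  produce a point of \<Omega>, so Hahn--Banach is needed in a form that controls the norm of the
  functional.\<close>

definition sublinear :: "('a::real_vector \<Rightarrow> real) \<Rightarrow> bool" where
  "sublinear p \<longleftrightarrow> (\<forall>x y. p (x + y) \<le> p x + p y) \<and> (\<forall>x c. 0 < c \<longrightarrow> p (c *\<^sub>R x) \<le> c * p x)"

lemma sublinearI:
  assumes "\<And>x y. p (x + y) \<le> p x + p y" "\<And>x c. 0 < c \<Longrightarrow> p (c *\<^sub>R x) \<le> c * p x"
  shows "sublinear p"
  using assms by (simp add: sublinear_def)

lemma sublinear_add: "sublinear p \<Longrightarrow> p (x + y) \<le> p x + p y"
  by (simp add: sublinear_def)

lemma sublinear_scale_le: "sublinear p \<Longrightarrow> 0 < c \<Longrightarrow> p (c *\<^sub>R x) \<le> c * p x"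
  by (simp add: sublinear_def)

lemma sublinear_0:
  assumes "sublinear p"
  shows "p 0 = 0"
  using sublinear_scale_le[OF assms, of "1/2" 0] sublinear_scale_le[OF assms, of 2 0] by simp

text \<open>The definition asks only for an inequality with positive factors, so that infima need
  checking on one side; applying it to \<open>1 / c\<close> as well yields equality.\<close>

lemma sublinear_scale:
  assumes "sublinear p" "0 \<le> c"
  shows "p (c *\<^sub>R x) = c * p x"
proof (cases "c = 0")
  case False
  then have "0 < c" using assms by simp
  moreover from this have "p x \<le> (1 / c) * p (c *\<^sub>R x)"
    using sublinear_scale_le[OF assms(1), of "1 / c" "c *\<^sub>R x"] by simp
  ultimately show ?thesis
    using sublinear_scale_le[OF assms(1), of c x] by (simp add: field_simps)
qed (simp add: sublinear_0[OF assms(1)])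

lemma sublinear_ge_neg:
  assumes "sublinear p"
  shows "- p (- x) \<le> p x"
  using sublinear_add[OF assms, of x "- x"] by (simp add: sublinear_0[OF assms])

lemma le_cINF_add:
  fixes f :: "'i \<Rightarrow> real" and g :: "'j \<Rightarrow> real"
  assumes "A \<noteq> {}" "B \<noteq> {}" "\<And>a b. a \<in> A \<Longrightarrow> b \<in> B \<Longrightarrow> v \<le> f a + g b"
  shows "v \<le> (INF a\<in>A. f a) + (INF b\<in>B. g b)"
proof -
  have "v - f a \<le> (INF b\<in>B. g b)" if "a \<in> A" for a
    using assms(2,3) that by (intro cINF_greatest) (auto simp: algebra_simps)
  then have "v - (INF b\<in>B. g b) \<le> (INF a\<in>A. f a)"
    using assms(1) by (intro cINF_greatest) (auto simp: algebra_simps)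
  then show ?thesis by simp
qed

lemma le_mult_cINF:
  fixes f :: "'i \<Rightarrow> real"
  assumes "A \<noteq> {}" "0 < c" "\<And>a. a \<in> A \<Longrightarrow> v \<le> c * f a"
  shows "v \<le> c * (INF a\<in>A. f a)"
proof -
  have "v / c \<le> (INF a\<in>A. f a)"
    using assms by (intro cINF_greatest) (auto simp: field_simps)
  then show ?thesis using assms(2) by (simp add: field_simps)
qed

text \<open>Moving x along y and subtracting the cost gives a sublinear \<open>q'\<close> below q.
  Minimality forces \<open>q' = q\<close>, and the competitor t = 1 is the inequality missing from
  subadditivity.\<close>

lemma minimal_sublinear_additive:
  assumes q: "sublinear q" and min: "\<And>q'. sublinear q' \<Longrightarrow> q' \<le> q \<Longrightarrow> q' = q"
  shows "q (x + y) = q x + q y"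
proof -
  define h where "h t x = q (x + t *\<^sub>R y) - t * q y" for t x
  define q' where "q' x = (INF t\<in>{0..}. h t x)" for x
  have bdd: "bdd_below ((\<lambda>t. h t x) ` {0..})" for x
  proof (rule bdd_belowI2)
    fix t :: real assume "t \<in> {0..}"
    then show "- q (- x) \<le> h t x"
      using sublinear_add[OF q, of "x + t *\<^sub>R y" "- x"] sublinear_scale[OF q, of t y]
      by (simp add: h_def)
  qed
  have lower: "q' x \<le> h t x" if "0 \<le> t" for t x
    unfolding q'_def by (intro cINF_lower bdd) (use that in auto)
  have "sublinear q'"
  proof (rule sublinearI)
    fix x1 x2
    have "q' (x1 + x2) \<le> h s x1 + h t x2" if "0 \<le> s" "0 \<le> t" for s t
      using lower[of "s + t" "x1 + x2"] that sublinear_add[OF q, of "x1 + s *\<^sub>R y" "x2 + t *\<^sub>R y"]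
      by (simp add: h_def algebra_simps)
    then show "q' (x1 + x2) \<le> q' x1 + q' x2"
      unfolding q'_def[of x1] q'_def[of x2] by (intro le_cINF_add) auto
  next
    fix x c assume c: "0 < (c::real)"
    have "q' (c *\<^sub>R x) \<le> c * h t x" if "0 \<le> t" for t
      using lower[of "c * t" "c *\<^sub>R x"] that c sublinear_scale[OF q, of c "x + t *\<^sub>R y"]
      by (simp add: h_def algebra_simps)
    then show "q' (c *\<^sub>R x) \<le> c * q' x"
      unfolding q'_def[of x] using c by (intro le_mult_cINF) auto
  qed
  moreover have "q' \<le> q"
    using lower[of 0] by (auto simp: le_fun_def h_def)
  ultimately have "q' = q" by (rule min)
  then have "q x \<le> q (x + y) - q y"
    using lower[of 1 x] by (simp add: h_def)
  with sublinear_add[OF q, of x y] show ?thesis by simp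
qed

text \<open>Hahn--Banach without a subspace to extend from: Zorn's lemma provides a minimal
  sublinear functional below p, and minimal ones are linear. The bound \<open>- p (- x)\<close>
  keeps infima of chains finite; they are subadditive because one of any two members of a chain lies
  below both.\<close>

lemma linear_below_sublinear:
  assumes p: "sublinear p"
  obtains f where "linear f" "\<And>x. f x \<le> p x"
proof -
  define S where "S = {q. sublinear q \<and> q \<le> p}"
  have "\<exists>m\<in>S. \<forall>q\<in>S. q \<le> m \<longrightarrow> q = m"
  proof (rule predicate_Zorn)
    \<comment> \<open>The order is reversed, so the maximal element given by Zorn's lemma is a
      minimal functional.\<close>
    show "partial_order_on S (relation_of (\<lambda>a b. b \<le> a) S)"
      by (rule partial_order_on_relation_ofI) auto
  next
    fix C assume "C \<in> Chains (relation_of (\<lambda>a b. b \<le> a) S)"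
    then have CS: "C \<subseteq> S" and chain: "\<And>a b. a \<in> C \<Longrightarrow> b \<in> C \<Longrightarrow> a \<le> b \<or> b \<le> a"
      by (auto simp: Chains_def relation_of_def)
    show "\<exists>u\<in>S. \<forall>a\<in>C. u \<le> a"
    proof (cases "C = {}")
      case True
      then show ?thesis using p by (auto simp: S_def)
    next
      case ne: False
      define u where "u x = (INF q\<in>C. q x)" for x
      have bdd: "bdd_below ((\<lambda>q. q x) ` C)" for x
      proof (rule bdd_belowI2)
        fix q assume "q \<in> C"
        then have "sublinear q" "q \<le> p" using CS by (auto simp: S_def)
        then show "- p (- x) \<le> q x"
          using sublinear_ge_neg[of q x] le_funD[of q p "- x"] by linarith
      qed
      have lower: "u x \<le> q x" if "q \<in> C" for q x
        unfolding u_def by (intro cINF_lower bdd that)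
      have "sublinear u"
      proof (rule sublinearI)
        fix x y
        have "u (x + y) \<le> q1 x + q2 y" if q12: "q1 \<in> C" "q2 \<in> C" for q1 q2
        proof -
          obtain q where q: "q \<in> C" "q \<le> q1" "q \<le> q2"
            using chain[OF q12] q12 by auto
          then have "u (x + y) \<le> q x + q y"
            using lower[OF q(1), of "x + y"] sublinear_add[of q x y] CS by (auto simp: S_def)
          then show ?thesis using le_funD[OF q(2), of x] le_funD[OF q(3), of y] by linarith
        qed
        then show "u (x + y) \<le> u x + u y"
          unfolding u_def[of x] u_def[of y] using ne by (intro le_cINF_add)
      next
        fix x c assume c: "0 < (c::real)"
        have "u (c *\<^sub>R x) \<le> c * q x" if "q \<in> C" for q
          using lower[OF that, of "c *\<^sub>R x"] sublinear_scale[of q c x] CS that c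
          by (auto simp: S_def)
        then show "u (c *\<^sub>R x) \<le> c * u x"
          unfolding u_def[of x] using ne c by (intro le_mult_cINF)
      qed
      moreover have "u \<le> p"
      proof -
        obtain q where "q \<in> C" using ne by blast
        then have "u \<le> q" "q \<le> p" using lower CS by (auto simp: le_fun_def S_def)
        then show ?thesis by (rule order_trans)
      qed
      ultimately have "u \<in> S" by (simp add: S_def)
      with lower show ?thesis by (auto simp: le_fun_def)
    qed
  qed
  then obtain m where m: "sublinear m" "m \<le> p" and min: "\<And>q. sublinear q \<Longrightarrow> q \<le> m \<Longrightarrow> q = m"
    unfolding S_def by (auto intro: order_trans)
  have add: "m (x + y) = m x + m y" for x y
    by (rule minimal_sublinear_additive[OF m(1) min])
  have neg: "m (- x) = - m x" for x
    using add[of x "- x"] by (simp add: sublinear_0[OF m(1)])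
  have "m (c *\<^sub>R x) = c * m x" for c x
  proof (cases "0 \<le> c")
    case True
    then show ?thesis by (rule sublinear_scale[OF m(1)])
  next
    case False
    then show ?thesis
      using neg[of "(- c) *\<^sub>R x"] sublinear_scale[OF m(1), of "- c" x] by simp
  qed
  then have "linear m" using add by (intro linearI) auto
  then show thesis using that m(2) by (auto simp: le_fun_def)
qed

text \<open>The sublinear functional \<open>x \<mapsto> inf {\<parallel>x + t c\<parallel> - t d | t \<ge> 0, c \<in> C}\<close> is at most \<open>\<parallel>x\<parallel>\<close>,
  and at most \<open>- d\<close> on \<open>- C\<close>; any linear functional below it therefore separates.\<close>

lemma separate_from_0:
  fixes C :: "'a::real_normed_vector set"
  assumes C: "convex C" "C \<noteq> {}" and d: "\<And>c. c \<in> C \<Longrightarrow> d \<le> norm c"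
  obtains f :: "'a \<Rightarrow>\<^sub>L real" where "norm f \<le> 1" "\<And>c. c \<in> C \<Longrightarrow> d \<le> blinfun_apply f c"
proof -
  define h where "h z x = norm (x + fst z *\<^sub>R snd z) - fst z * d" for z :: "real \<times> 'a" and x
  define I where "I = {0::real..} \<times> C"
  define p where "p x = (INF z\<in>I. h z x)" for x
  have ne: "I \<noteq> {}" using C by (auto simp: I_def)
  have bdd: "bdd_below ((\<lambda>z. h z x) ` I)" for x
  proof (rule bdd_belowI2)
    fix z assume "z \<in> I"
    then have "fst z * d \<le> norm (fst z *\<^sub>R snd z)"
      using d by (auto simp: I_def intro!: mult_left_mono)
    then show "- norm x \<le> h z x"
      using norm_triangle_ineq4[of "x + fst z *\<^sub>R snd z" x] by (simp add: h_def)
  qed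
  have lower: "p x \<le> h (t, c) x" if "0 \<le> t" "c \<in> C" for t c x
    unfolding p_def by (intro cINF_lower bdd) (use that in \<open>auto simp: I_def\<close>)
  have "sublinear p"
  proof (rule sublinearI)
    fix x y
    have "p (x + y) \<le> h z x + h z' y" if "z \<in> I" "z' \<in> I" for z z'
    proof -
      obtain s c t c' where z: "z = (s, c)" "z' = (t, c')" by (cases z; cases z'; blast)
      with that have st: "0 \<le> s" "0 \<le> t" "c \<in> C" "c' \<in> C" by (auto simp: I_def)
      \<comment> \<open>Convexity merges the two directions into a single one with weight s + t; if
        both weights are 0, any point of C will do.\<close>
      obtain e where e: "e \<in> C" "(s + t) *\<^sub>R e = s *\<^sub>R c + t *\<^sub>R c'"
      proof (cases "s + t = 0")
        case True
        then have "s = 0" "t = 0" using st by auto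
        then show ?thesis using that[of c] st by simp
      next
        case False
        then have pos: "0 < s + t" using st by simp
        have "(s / (s + t)) *\<^sub>R c + (t / (s + t)) *\<^sub>R c' \<in> C"
          using st pos by (intro convexD[OF C(1)]) (auto simp: add_divide_distrib[symmetric])
        moreover have "(s + t) *\<^sub>R ((s / (s + t)) *\<^sub>R c + (t / (s + t)) *\<^sub>R c') = s *\<^sub>R c + t *\<^sub>R c'"
          using pos by (simp add: scaleR_add_right)
        ultimately show ?thesis by (rule that)
      qed
      have "p (x + y) \<le> norm (x + y + (s + t) *\<^sub>R e) - (s + t) * d"
        using lower[of "s + t" e "x + y"] st e by (simp add: h_def)
      also have "x + y + (s + t) *\<^sub>R e = (x + s *\<^sub>R c) + (y + t *\<^sub>R c')"
        by (simp add: e(2))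
      also have "norm \<dots> - (s + t) * d \<le> h z x + h z' y"
        using norm_triangle_ineq[of "x + s *\<^sub>R c" "y + t *\<^sub>R c'"]
        by (simp add: h_def z algebra_simps)
      finally show ?thesis .
    qed
    then show "p (x + y) \<le> p x + p y"
      unfolding p_def[of x] p_def[of y] by (intro le_cINF_add ne)
  next
    fix x and a :: real assume a: "0 < a"
    have "p (a *\<^sub>R x) \<le> a * h z x" if zI: "z \<in> I" for z
    proof -
      obtain t c where z: "z = (t, c)" "0 \<le> t" "c \<in> C" using zI unfolding I_def by fastforce
      have "p (a *\<^sub>R x) \<le> norm (a *\<^sub>R (x + t *\<^sub>R c)) - a * t * d"
        using lower[of "a * t" c "a *\<^sub>R x"] z a by (simp add: h_def scaleR_add_right)
      also have "\<dots> = a * h z x"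
        by (simp only: h_def z(1) fst_conv snd_conv norm_scaleR abs_of_pos[OF a]
            right_diff_distrib mult.assoc)
      finally show ?thesis .
    qed
    then show "p (a *\<^sub>R x) \<le> a * p x"
      unfolding p_def[of x] using a by (intro le_mult_cINF ne)
  qed
  then obtain f where f: "linear f" "\<And>x. f x \<le> p x"
    by (rule linear_below_sublinear) (blast intro: that)
  have le: "f x \<le> norm x" for x
  proof -
    obtain c where "c \<in> C" using C by blast
    then show ?thesis using f(2)[of x] lower[of 0 c x] by (simp add: h_def)
  qed
  have abs: "\<bar>f x\<bar> \<le> norm x" for x
    using le[of x] le[of "- x"] linear_neg[OF f(1), of x] by simp
  have "bounded_linear f"
    using f(1) abs by (intro bounded_linear_intro[where K = 1]) (auto simp: linear_add linear_scale)
  then have fe: "blinfun_apply (Blinfun f) = f" by (rule bounded_linear_Blinfun_apply)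
  show thesis
  proof
    show "norm (Blinfun f) \<le> 1"
      by (rule norm_blinfun_bound) (use abs fe in auto)
    fix c assume "c \<in> C"
    \<comment> \<open>Weight 1 in the direction c cancels the norm term at - c, leaving only -
      d.\<close>
    then have "f (- c) \<le> - d"
      using f(2)[of "- c"] lower[of 1 c "- c"] by (simp add: h_def)
    then show "d \<le> blinfun_apply (Blinfun f) c"
      by (simp add: fe linear_neg[OF f(1)])
  qed
qed

text \<open>The translate a - C keeps a positive distance from 0. Norm at most 1 makes the
  separating functional a point of \<Omega>, where support functions can be compared.\<close>

lemma separate_point_convex:
  fixes C :: "'a::real_normed_vector set"
  assumes "convex C" "C \<noteq> {}" "a \<notin> closure C"
  obtains \<omega> e where "0 < e" "\<And>c. c \<in> C \<Longrightarrow> blinfun_apply (functional \<omega>) c + e \<le> blinfun_apply (functional \<omega>) a"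
proof -
  obtain e where e: "0 < e" "\<And>c. c \<in> C \<Longrightarrow> e \<le> dist c a"
    using assms(3) by (force simp: closure_approachable not_less)
  have "convex ((\<lambda>c. a - c) ` C)"
    using convex_translation[OF convex_negations[OF assms(1)], of a] by (simp add: image_image)
  moreover have "(\<lambda>c. a - c) ` C \<noteq> {}" using assms(2) by simp
  moreover have "e \<le> norm x" if "x \<in> (\<lambda>c. a - c) ` C" for x
    using e(2) that by (auto simp: dist_norm norm_minus_commute)
  ultimately obtain f :: "'a \<Rightarrow>\<^sub>L real" where
    f: "norm f \<le> 1" "\<And>x. x \<in> (\<lambda>c. a - c) ` C \<Longrightarrow> e \<le> blinfun_apply f x"
    by (rule separate_from_0) (blast intro: that)+
  have "functional (Abs_dual_ball f) = f"
    using f(1) by (intro Abs_dual_ball_inverse) simp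
  with f(2) show thesis
    by (intro that[of e "Abs_dual_ball f"] e(1)) (force simp: blinfun.diff_right)
qed


section \<open>Support functions and the space \<open>E\<^sub>C\<close>\<close>

lemma bounded_sets_plus:
  "A \<in> bounded_sets \<Longrightarrow> B \<in> bounded_sets \<Longrightarrow> A + B \<in> bounded_sets"
  by (auto simp: bounded_sets_def set_plus_image intro!: bounded_plus)

lemma bounded_sets_scale: "A \<in> bounded_sets \<Longrightarrow> c \<cdot> A \<in> bounded_sets"
  by (auto simp: bounded_sets_def bounded_scaling)

lemma bounded_sets_union:
  "A \<in> bounded_sets \<Longrightarrow> B \<in> bounded_sets \<Longrightarrow> A \<union> B \<in> bounded_sets"
  by (auto simp: bounded_sets_def)

lemma bounded_sets_finite: "finite F \<Longrightarrow> F \<noteq> {} \<Longrightarrow> F \<in> bounded_sets"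
  by (auto simp: bounded_sets_def finite_imp_bounded)

lemma bounded_sets_ball: "cball 0 1 \<in> bounded_sets"
  by (auto simp: bounded_sets_def)

lemma bounded_sets_hull: "A \<in> bounded_sets \<Longrightarrow> convex hull A \<in> bounded_sets"
  by (auto simp: bounded_sets_def bounded_convex_hull)

lemma closed_bounded_convex_subset_bounded: "closed_bounded_convex_sets \<subseteq> bounded_sets"
  by (auto simp: bounded_sets_def closed_bounded_convex_sets_def)

lemma compact_convex_subset_closed_bounded_convex:
  "compact_convex_sets \<subseteq> closed_bounded_convex_sets"
  by (auto simp: closed_bounded_convex_sets_def compact_convex_sets_def
      compact_imp_closed compact_imp_bounded)

lemma closed_hull_closed_bounded_convex:
  "A \<in> bounded_sets \<Longrightarrow> closed_hull A \<in> closed_bounded_convex_sets"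
  by (auto simp: closed_bounded_convex_sets_def bounded_sets_def bounded_convex_hull)

lemmas bounded_sets_intros = bounded_sets_plus bounded_sets_scale bounded_sets_union
  bounded_sets_ball

section \<open>Calculus of support functions\<close>

lemma J_upper:
  assumes "B \<in> bounded_sets" "b \<in> B"
  shows "blinfun_apply (functional \<omega>) b \<le> J B \<omega>"
proof -
  obtain M where M: "\<And>b. b \<in> B \<Longrightarrow> norm b \<le> M"
    using assms(1) by (auto simp: bounded_sets_def bounded_pos)
  have "bdd_above ((\<lambda>b. blinfun_apply (functional \<omega>) b) ` B)"
    by (intro bdd_aboveI2[where M = M] abs_le_D1[OF functional_abs_le[OF M]])
  then show ?thesis
    unfolding J_apply[OF assms(1)] using assms(2) by (intro cSUP_upper)
qed

lemma J_least:
  assumes "B \<in> bounded_sets" "\<And>b. b \<in> B \<Longrightarrow> blinfun_apply (functional \<omega>) b \<le> c"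
  shows "J B \<omega> \<le> c"
  unfolding J_apply[OF assms(1)]
  using assms by (intro cSUP_least) (auto simp: bounded_sets_def)

lemma J_mono:
  assumes "A \<in> bounded_sets" "B \<in> bounded_sets" "A \<subseteq> B"
  shows "J A \<omega> \<le> J B \<omega>"
  using assms by (intro J_least[OF assms(1)] J_upper) auto

lemma J_plus:
  fixes A B :: "'a::real_normed_vector set"
  assumes A: "A \<in> bounded_sets" and B: "B \<in> bounded_sets"
  shows "J (A + B) = J A + J B"
proof (rule bcontfun_eqI)
  fix \<omega> :: "'a dual_ball"
  let ?f = "blinfun_apply (functional \<omega>)"
  have AB: "A + B \<in> bounded_sets" by (rule bounded_sets_plus[OF A B])
  have "J (A + B) \<omega> \<le> J A \<omega> + J B \<omega>"
    by (rule J_least[OF AB])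
      (auto simp: set_plus_def blinfun.add_right intro!: add_mono J_upper A B)
  moreover have "J B \<omega> \<le> J (A + B) \<omega> - J A \<omega>"
  proof (rule J_least[OF B])
    fix b assume b: "b \<in> B"
    have "?f a \<le> J (A + B) \<omega> - ?f b" if "a \<in> A" for a
      using J_upper[OF AB set_plus_intro[OF that b], of \<omega>] by (simp add: blinfun.add_right)
    then have "J A \<omega> \<le> J (A + B) \<omega> - ?f b" by (rule J_least[OF A])
    then show "?f b \<le> J (A + B) \<omega> - J A \<omega>" by simp
  qed
  ultimately show "J (A + B) \<omega> = (J A + J B) \<omega>" by simp
qed

lemma J_singleton: "J {x} \<omega> = blinfun_apply (functional \<omega>) x"
  by (intro antisym J_least J_upper) (auto simp: bounded_sets_def)

lemma J_homogeneous:
  assumes B: "B \<in> bounded_sets" and t: "0 \<le> t" and eq: "functional \<eta> = t *\<^sub>R functional \<omega>"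
  shows "J B \<eta> = t * J B \<omega>"
proof (cases "t = 0")
  case True
  then have "J B \<eta> \<le> 0" "0 \<le> J B \<eta>"
    using B eq J_upper[OF B, of _ \<eta>] by (auto intro!: J_least simp: bounded_sets_def)
  then show ?thesis using True by simp
next
  case False
  then have t: "0 < t" using t by simp
  have "J B \<eta> \<le> t * J B \<omega>"
    using t by (intro J_least[OF B]) (auto simp: eq blinfun.scaleR_left intro!: J_upper B)
  moreover have "J B \<omega> \<le> J B \<eta> / t"
    using t J_upper[OF B, of _ \<eta>]
    by (intro J_least[OF B]) (auto simp: eq blinfun.scaleR_left field_simps)
  ultimately show ?thesis using t by (simp add: field_simps)
qed

lemma J_scale:
  fixes B :: "'a::real_normed_vector set"
  assumes B: "B \<in> bounded_sets" and c: "0 \<le> c"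
  shows "J (c \<cdot> B) = c *\<^sub>R J B"
proof (rule bcontfun_eqI)
  fix \<omega> :: "'a dual_ball"
  have cB: "c \<cdot> B \<in> bounded_sets" by (rule bounded_sets_scale[OF B])
  have "J (c \<cdot> B) \<omega> = c * J B \<omega>"
  proof (cases "c = 0")
    case True
    then have "c \<cdot> B = {0}" using B by (auto simp: bounded_sets_def)
    then show ?thesis using True by (simp add: J_singleton)
  next
    case False
    then have c: "0 < c" using c by simp
    have "J (c \<cdot> B) \<omega> \<le> c * J B \<omega>"
      using c by (intro J_least[OF cB]) (auto simp: blinfun.scaleR_right intro!: J_upper B)
    moreover have "J B \<omega> \<le> J (c \<cdot> B) \<omega> / c"
      using c J_upper[OF cB, of _ \<omega>]
      by (intro J_least[OF B]) (force simp: blinfun.scaleR_right field_simps)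
    ultimately show ?thesis using c by (simp add: field_simps)
  qed
  then show "J (c \<cdot> B) \<omega> = (c *\<^sub>R J B) \<omega>" by simp
qed

lemma J_union:
  assumes A: "A \<in> bounded_sets" and B: "B \<in> bounded_sets"
  shows "J (A \<union> B) \<omega> = max (J A \<omega>) (J B \<omega>)"
proof (rule antisym)
  show "J (A \<union> B) \<omega> \<le> max (J A \<omega>) (J B \<omega>)"
    using J_upper[OF A] J_upper[OF B]
    by (intro J_least bounded_sets_union A B) (auto simp: le_max_iff_disj)
  show "max (J A \<omega>) (J B \<omega>) \<le> J (A \<union> B) \<omega>"
    by (auto intro!: J_mono bounded_sets_union A B)
qed

lemma J_closed_hull:
  fixes B :: "'a::real_normed_vector set"
  assumes B: "B \<in> bounded_sets"
  shows "J (closed_hull B) = J B"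
proof (rule bcontfun_eqI)
  fix \<omega> :: "'a dual_ball"
  let ?f = "blinfun_apply (functional \<omega>)"
  have cB: "closed_hull B \<in> bounded_sets"
    using closed_hull_closed_bounded_convex[OF B] closed_bounded_convex_subset_bounded by blast
  have "closed {x. ?f x \<le> J B \<omega>}"
    by (intro closed_Collect_le continuous_intros)
  moreover have "convex {x. ?f x \<le> J B \<omega>}"
    by (auto simp: convex_def blinfun.add_right blinfun.scaleR_right intro!: convex_bound_le)
  ultimately have "closed_hull B \<subseteq> {x. ?f x \<le> J B \<omega>}"
    by (intro closure_minimal hull_minimal) (auto intro: J_upper B)
  then have "J (closed_hull B) \<omega> \<le> J B \<omega>"
    by (intro J_least[OF cB]) auto
  moreover have "J B \<omega> \<le> J (closed_hull B) \<omega>"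
    by (intro J_mono B cB) (meson closure_subset hull_subset order_trans)
  ultimately show "J (closed_hull B) \<omega> = J B \<omega>" by simp
qed

text \<open>This is the dual norm as a supremum over the unit ball. It is 1 on the unit sphere,
  which lets it stand in for the constant 1.\<close>

lemma J_ball: "J (cball 0 1) \<omega> = norm (functional \<omega>)"
proof (rule antisym)
  let ?f = "blinfun_apply (functional \<omega>)"
  have "?f b \<le> norm (functional \<omega>)" if "norm b \<le> 1" for b
    using norm_blinfun[of "functional \<omega>" b] mult_left_mono[OF that, of "norm (functional \<omega>)"]
    by simp
  then show "J (cball 0 1) \<omega> \<le> norm (functional \<omega>)"
    by (intro J_least bounded_sets_ball) auto
  have upper: "?f b \<le> J (cball 0 1) \<omega>" if "norm b \<le> 1" for b
    using that by (intro J_upper bounded_sets_ball) simp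
  have le: "?f x \<le> J (cball 0 1) \<omega> * norm x" for x
  proof (cases "x = 0")
    case False
    then have "?f (inverse (norm x) *\<^sub>R x) \<le> J (cball 0 1) \<omega>"
      by (intro upper) simp
    then show ?thesis using False by (simp add: blinfun.scaleR_right field_simps)
  qed simp
  have "norm (?f x) \<le> J (cball 0 1) \<omega> * norm x" for x
    using le[of x] le[of "- x"] by (auto simp: blinfun.minus_right)
  then show "norm (functional \<omega>) \<le> J (cball 0 1) \<omega>"
    using upper[of 0] by (intro norm_blinfun_bound) auto
qed

section \<open>Lattice operations and homogeneity in \<open>E\<^sub>C\<close>\<close>

lemma bounded_linear_apply_bcontfun:
  "bounded_linear (\<lambda>u :: 'a::topological_space \<Rightarrow>\<^sub>C 'b::real_normed_vector. apply_bcontfun u x)"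
  by (rule bounded_linear_intro[where K = 1]) (auto simp: norm_bounded)

definition babs :: "('a::topological_space \<Rightarrow>\<^sub>C real) \<Rightarrow> ('a \<Rightarrow>\<^sub>C real)" where
  "babs u = Bcontfun (\<lambda>x. \<bar>u x\<bar>)"

lemma babs_apply [simp]: "babs u x = \<bar>u x\<bar>"
proof -
  have "(\<lambda>x. \<bar>u x\<bar>) \<in> bcontfun"
    using norm_bounded[of u] by (intro bcontfun_normI[where b = "norm u"] continuous_intros) auto
  then show ?thesis by (simp add: babs_def Bcontfun_inverse)
qed

lemma continuous_on_babs: "continuous_on S babs"
proof -
  have "dist (babs u) (babs v) \<le> 1 * dist u v" for u v :: "'a \<Rightarrow>\<^sub>C real"
  proof -
    have "dist (babs u x) (babs v x) \<le> dist u v" for x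
      using dist_bounded[of u x v] by (simp add: dist_real_def)
    then show ?thesis using dist_bound[of "babs u" "babs v"] by simp
  qed
  then have "1-lipschitz_on S babs" by (auto simp: lipschitz_on_def)
  then show ?thesis by (rule lipschitz_on_continuous_on)
qed

text \<open>Closed hulls do not change support functions, so later constructions may use sums,
  unions and finite sets without closing or convexifying them.\<close>

lemma E_C_eq:
  "E\<^sub>C = closure {J A - J B | A B :: 'a::real_normed_vector set. A \<in> bounded_sets \<and> B \<in> bounded_sets}"
proof -
  have "\<exists>A' B'. J A - J B = J A' - J B' \<and> A' \<in> closed_bounded_convex_sets
      \<and> B' \<in> closed_bounded_convex_sets"
    if "A \<in> bounded_sets" "B \<in> bounded_sets" for A B :: "'a set"
    using that by (intro exI[of _ "closed_hull A"] exI[of _ "closed_hull B"])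
      (simp add: J_closed_hull closed_hull_closed_bounded_convex)
  then have "{J A - J B | A B :: 'a set. A \<in> closed_bounded_convex_sets \<and> B \<in> closed_bounded_convex_sets}
      = {J A - J B | A B. A \<in> bounded_sets \<and> B \<in> bounded_sets}"
    using closed_bounded_convex_subset_bounded by blast
  then show ?thesis by (simp add: E_space_def)
qed

lemma closed_E_space: "closed (E_space \<S>)"
  by (simp add: E_space_def)

lemma diff_in_E_C:
  "A \<in> bounded_sets \<Longrightarrow> B \<in> bounded_sets \<Longrightarrow> J A - J B \<in> E\<^sub>C"
  unfolding E_C_eq by (rule subsetD[OF closure_subset]) blast

lemma J_in_E_C:
  assumes "B \<in> bounded_sets"
  shows "J B \<in> E\<^sub>C"
proof -
  have "J B = J B - J {0}" by (rule bcontfun_eqI) (simp add: J_singleton)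
  then show ?thesis
    using diff_in_E_C[OF assms, of "{0}"] bounded_sets_finite[of "{0}"] by simp
qed

lemma diff_in_E_K: "J {x} - J {y} \<in> E\<^sub>K"
  unfolding E_space_def
  by (intro subsetD[OF closure_subset] CollectI exI[of _ "{x}"] exI[of _ "{y}"])
    (auto simp: compact_convex_sets_def)

lemma zero_in_E_K: "0 \<in> E\<^sub>K"
  using diff_in_E_K[of 0 0] by simp

lemma subspace_closure:
  fixes S :: "'a::real_normed_vector set"
  assumes "subspace S"
  shows "subspace (closure S)"
proof (rule subspaceI)
  show "0 \<in> closure S"
    using subspace_0[OF assms] closure_subset by blast
  show "x + y \<in> closure S" if xy: "x \<in> closure S" "y \<in> closure S" for x y
  proof -
    obtain f g where "\<And>n. f n \<in> S" "f \<longlonglongrightarrow> x" "\<And>n. g n \<in> S" "g \<longlonglongrightarrow> y"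
      using xy by (auto simp: closure_sequential)
    then show ?thesis
      unfolding closure_sequential
      by (intro exI[of _ "\<lambda>n. f n + g n"]) (auto intro: tendsto_intros subspace_add[OF assms])
  qed
  show "c *\<^sub>R x \<in> closure S" if x: "x \<in> closure S" for x c
  proof -
    obtain f where "\<And>n. f n \<in> S" "f \<longlonglongrightarrow> x"
      using x by (auto simp: closure_sequential)
    then show ?thesis
      unfolding closure_sequential
      by (intro exI[of _ "\<lambda>n. c *\<^sub>R f n"]) (auto intro: tendsto_intros subspace_scale[OF assms])
  qed
qed

lemma subspace_E_C: "subspace E\<^sub>C"
  unfolding E_C_eq
proof (intro subspace_closure subspaceI)
  let ?S = "{J A - J B | A B :: 'a set. A \<in> bounded_sets \<and> B \<in> bounded_sets}"
  have I: "J A - J B \<in> ?S" if "A \<in> bounded_sets" "B \<in> bounded_sets" for A B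
    using that by blast
  show "0 \<in> ?S" using I[OF bounded_sets_ball bounded_sets_ball] by simp
  show "u + v \<in> ?S" if uv: "u \<in> ?S" "v \<in> ?S" for u v
  proof -
    obtain A B C D where *: "u = J A - J B" "v = J C - J D"
      "A \<in> bounded_sets" "B \<in> bounded_sets" "C \<in> bounded_sets" "D \<in> bounded_sets"
      using uv by blast
    then have "u + v = J (A + C) - J (B + D)" by (simp add: J_plus)
    with I[of "A + C" "B + D"] show ?thesis by (simp only: * bounded_sets_plus)
  qed
  show "c *\<^sub>R u \<in> ?S" if u: "u \<in> ?S" for c u
  proof -
    obtain A B where *: "u = J A - J B" "A \<in> bounded_sets" "B \<in> bounded_sets"
      using u by blast
    show ?thesis
    proof (cases "0 \<le> c")
      case True
      then have "c *\<^sub>R u = J (c \<cdot> A) - J (c \<cdot> B)"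
        using * by (simp add: J_scale scaleR_diff_right)
      with I[of "c \<cdot> A" "c \<cdot> B"] show ?thesis by (simp only: * bounded_sets_scale)
    next
      case False
      then have "c *\<^sub>R u = J ((- c) \<cdot> B) - J ((- c) \<cdot> A)"
        using * J_scale[of B "- c"] J_scale[of A "- c"] by (simp add: scaleR_diff_right)
      with I[of "(- c) \<cdot> B" "(- c) \<cdot> A"] show ?thesis by (simp only: * bounded_sets_scale)
    qed
  qed
qed

text \<open>The identity \<bar>a - b\<bar> = 2 max(a, b) - (a + b) is realised by sets: unions give
  maxima and Minkowski sums give sums. Continuity of \<open>babs\<close> extends this to the
  closure.\<close>

lemma babs_in_E_C:
  assumes "u \<in> E\<^sub>C"
  shows "babs u \<in> E\<^sub>C"
proof -
  let ?S = "{J A - J B | A B :: 'a set. A \<in> bounded_sets \<and> B \<in> bounded_sets}"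
  have "babs v \<in> E\<^sub>C" if v: "v \<in> ?S" for v
  proof -
    obtain A B where v: "v = J A - J B" and AB: "A \<in> bounded_sets" "B \<in> bounded_sets"
      using v by blast
    have "babs v = J (2 \<cdot> (A \<union> B)) - J (A + B)"
      using AB by (intro bcontfun_eqI)
        (auto simp: v J_scale J_union J_plus bounded_sets_union max_def)
    then show ?thesis using AB by (simp add: diff_in_E_C bounded_sets_intros)
  qed
  then have "babs ` closure ?S \<subseteq> E\<^sub>C"
    by (intro image_closure_subset continuous_on_babs closed_E_space) auto
  then show ?thesis using assms unfolding E_C_eq by blast
qed

text \<open>Homogeneity at a fixed pair of points is a closed linear condition that holds for all
  differences of support functions.\<close>

lemma E_C_homogeneous:
  fixes u :: "'a::real_normed_vector dual_ball \<Rightarrow>\<^sub>C real"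
  assumes u: "u \<in> E\<^sub>C" and t: "0 \<le> t" and eq: "functional \<eta> = t *\<^sub>R functional \<omega>"
  shows "u \<eta> = t * u \<omega>"
proof -
  note [continuous_intros] = bounded_linear.continuous_on[OF bounded_linear_apply_bcontfun]
  have "E\<^sub>C \<subseteq> {u :: 'a dual_ball \<Rightarrow>\<^sub>C real. apply_bcontfun u \<eta> = t * apply_bcontfun u \<omega>}"
    unfolding E_C_eq
  proof (rule closure_minimal)
    show "closed {u :: 'a dual_ball \<Rightarrow>\<^sub>C real. apply_bcontfun u \<eta> = t * apply_bcontfun u \<omega>}"
      by (intro closed_Collect_eq continuous_intros)
  qed (auto simp: J_homogeneous[OF _ t eq] right_diff_distrib)
  then show ?thesis using u by blast
qed

text \<open>Each value is a nonnegative multiple of a value on the sphere, or is 0 at the zero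
  functional. This makes estimates by constants usable although the constants lie outside
  \<open>E\<^sub>C\<close>.\<close>

lemma E_C_nonpos_of_sphere:
  assumes u: "u \<in> E\<^sub>C" and sphere: "\<And>\<omega>. norm (functional \<omega>) = 1 \<Longrightarrow> u \<omega> \<le> 0"
  shows "u \<omega> \<le> 0"
proof (cases "functional \<omega> = 0")
  case True
  then show ?thesis using E_C_homogeneous[OF u, of 0 \<omega> \<omega>] by simp
next
  case False
  define \<eta> where "\<eta> = Abs_dual_ball (inverse (norm (functional \<omega>)) *\<^sub>R functional \<omega>)"
  have \<eta>: "functional \<eta> = inverse (norm (functional \<omega>)) *\<^sub>R functional \<omega>"
    using False unfolding \<eta>_def by (intro Abs_dual_ball_inverse) simp
  then have "u \<omega> = norm (functional \<omega>) * u \<eta>"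
    using False by (intro E_C_homogeneous[OF u]) auto
  moreover have "u \<eta> \<le> 0"
    using False by (intro sphere) (simp add: \<eta>)
  ultimately show ?thesis by (simp add: mult_nonneg_nonpos)
qed

text \<open>A closed lattice ideal containing \<open>E\<^sub>K\<close>, in which the elements that vanish in the quotient
  are controlled by finite sets; a measure of non-property \<open>\<DD>\<close> is \<open>0\<close> on those.\<close>

definition finitely_dominated :: "('a::real_normed_vector dual_ball \<Rightarrow>\<^sub>C real) set" where
  "finitely_dominated =
     {u \<in> E\<^sub>C. \<forall>e>0. \<exists>F. finite F \<and> F \<noteq> {} \<and> (\<forall>\<omega>. \<bar>u \<omega>\<bar> \<le> J F \<omega> + e)}"

lemma finitely_dominatedD:
  assumes "u \<in> finitely_dominated" "0 < e"
  shows "\<exists>F. finite F \<and> F \<noteq> {} \<and> (\<forall>\<omega>. \<bar>u \<omega>\<bar> \<le> J F \<omega> + e)"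
  using assms unfolding finitely_dominated_def by blast

lemma closed_finitely_dominated: "closed finitely_dominated"
proof -
  have "u \<in> finitely_dominated" if u: "u \<in> closure finitely_dominated" for u :: "'a dual_ball \<Rightarrow>\<^sub>C real"
  proof -
    have "closure finitely_dominated \<subseteq> (E\<^sub>C :: ('a dual_ball \<Rightarrow>\<^sub>C real) set)"
      by (intro closure_minimal closed_E_space) (auto simp: finitely_dominated_def)
    moreover have "\<exists>F. finite F \<and> F \<noteq> {} \<and> (\<forall>\<omega>. \<bar>u \<omega>\<bar> \<le> J F \<omega> + e)" if e: "0 < e" for e
    proof -
      obtain v where v: "v \<in> finitely_dominated" "dist v u < e / 2"
        using u e by (meson closure_approachable half_gt_zero)
      obtain F where F: "finite F" "F \<noteq> {}" "\<And>\<omega>. \<bar>v \<omega>\<bar> \<le> J F \<omega> + e / 2"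
        using finitely_dominatedD[OF v(1), of "e / 2"] e by auto
      have "\<bar>u \<omega>\<bar> \<le> J F \<omega> + e" for \<omega>
        using F(3)[of \<omega>] dist_bounded[of v \<omega> u] v(2) unfolding dist_real_def by linarith
      then show ?thesis using F by blast
    qed
    ultimately show ?thesis using u by (auto simp: finitely_dominated_def)
  qed
  then show ?thesis by (metis closure_subset_eq subsetI)
qed

lemma subspace_finitely_dominated: "subspace finitely_dominated"
proof (rule subspaceI)
  show "0 \<in> finitely_dominated"
    by (auto simp: finitely_dominated_def subspace_0[OF subspace_E_C] J_singleton
        intro!: exI[of _ "{0}"])
next
  fix u v :: "'a dual_ball \<Rightarrow>\<^sub>C real"
  assume uv: "u \<in> finitely_dominated" "v \<in> finitely_dominated"
  have "\<exists>F. finite F \<and> F \<noteq> {} \<and> (\<forall>\<omega>. \<bar>(u + v) \<omega>\<bar> \<le> J F \<omega> + e)" if e: "0 < e" for e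
  proof -
    obtain F where F: "finite F" "F \<noteq> {}" "\<And>\<omega>. \<bar>u \<omega>\<bar> \<le> J F \<omega> + e / 2"
      using finitely_dominatedD[OF uv(1), of "e / 2"] e by auto
    obtain G where G: "finite G" "G \<noteq> {}" "\<And>\<omega>. \<bar>v \<omega>\<bar> \<le> J G \<omega> + e / 2"
      using finitely_dominatedD[OF uv(2), of "e / 2"] e by auto
    have "\<bar>(u + v) \<omega>\<bar> \<le> J (F + G) \<omega> + e" for \<omega>
      using F(3)[of \<omega>] G(3)[of \<omega>] F(1,2) G(1,2) abs_triangle_ineq[of "u \<omega>" "v \<omega>"]
      by (simp add: J_plus bounded_sets_finite)
    then show ?thesis
      using F(1,2) G(1,2) by (intro exI[of _ "F + G"] conjI allI) (simp_all add: finite_set_plus set_plus_image)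
  qed
  then show "u + v \<in> finitely_dominated"
    using uv subspace_add[OF subspace_E_C] by (auto simp: finitely_dominated_def)
next
  fix c and u :: "'a dual_ball \<Rightarrow>\<^sub>C real"
  assume u: "u \<in> finitely_dominated"
  have "\<exists>F. finite F \<and> F \<noteq> {} \<and> (\<forall>\<omega>. \<bar>(c *\<^sub>R u) \<omega>\<bar> \<le> J F \<omega> + e)" if e: "0 < e" for e
  proof -
    obtain F where F: "finite F" "F \<noteq> {}" "\<And>\<omega>. \<bar>u \<omega>\<bar> \<le> J F \<omega> + e / (\<bar>c\<bar> + 1)"
      using finitely_dominatedD[OF u, of "e / (\<bar>c\<bar> + 1)"] e by auto
    have "\<bar>(c *\<^sub>R u) \<omega>\<bar> \<le> J (\<bar>c\<bar> \<cdot> F) \<omega> + e" for \<omega>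
    proof -
      have "\<bar>(c *\<^sub>R u) \<omega>\<bar> \<le> \<bar>c\<bar> * (J F \<omega> + e / (\<bar>c\<bar> + 1))"
        using F(3)[of \<omega>] by (simp add: abs_mult mult_left_mono)
      also have "\<bar>c\<bar> * (e / (\<bar>c\<bar> + 1)) \<le> e" using e by (simp add: field_simps)
      then have "\<bar>c\<bar> * (J F \<omega> + e / (\<bar>c\<bar> + 1)) \<le> \<bar>c\<bar> * J F \<omega> + e"
        unfolding distrib_left by simp
      finally show ?thesis using F by (simp add: J_scale bounded_sets_finite)
    qed
    then show ?thesis using F by (intro exI[of _ "\<bar>c\<bar> \<cdot> F"]) auto
  qed
  then show "c *\<^sub>R u \<in> finitely_dominated"
    using u subspace_scale[OF subspace_E_C] by (auto simp: finitely_dominated_def)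
qed

lemma lattice_ideal_finitely_dominated: "lattice_ideal finitely_dominated"
  unfolding lattice_ideal_def
proof (intro conjI ballI impI subspace_finitely_dominated)
  show "finitely_dominated \<subseteq> (E\<^sub>C :: ('a dual_ball \<Rightarrow>\<^sub>C real) set)"
    unfolding finitely_dominated_def by blast
  fix u v :: "'a dual_ball \<Rightarrow>\<^sub>C real"
  assume u: "u \<in> E\<^sub>C" and v: "v \<in> finitely_dominated" and le: "\<forall>\<omega>. \<bar>u \<omega>\<bar> \<le> \<bar>v \<omega>\<bar>"
  have "\<exists>F. finite F \<and> F \<noteq> {} \<and> (\<forall>\<omega>. \<bar>u \<omega>\<bar> \<le> J F \<omega> + e)" if e: "0 < e" for e
  proof -
    obtain F where F: "finite F" "F \<noteq> {}" "\<And>\<omega>. \<bar>v \<omega>\<bar> \<le> J F \<omega> + e"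
      using finitely_dominatedD[OF v e] by auto
    then show ?thesis using order_trans[OF le[rule_format] F(3)] by blast
  qed
  with u show "u \<in> finitely_dominated" by (simp add: finitely_dominated_def)
qed

text \<open>Total boundedness gives a finite e/2-net. Adding the negatives of A and B to the set
  being covered bounds their support functions from below as well as from above; the factor 2 on F
  accounts for the two terms of the difference.\<close>

lemma E_K_subset_finitely_dominated: "E\<^sub>K \<subseteq> finitely_dominated"
  unfolding E_space_def
proof (rule closure_minimal[OF _ closed_finitely_dominated], safe)
  fix A B :: "'a set"
  assume AB: "A \<in> compact_convex_sets" "B \<in> compact_convex_sets"
  then have bounded: "A \<in> bounded_sets" "B \<in> bounded_sets"
    using compact_convex_subset_closed_bounded_convex closed_bounded_convex_subset_bounded by auto
  have "\<exists>F. finite F \<and> F \<noteq> {} \<and> (\<forall>\<omega>. \<bar>(J A - J B) \<omega>\<bar> \<le> J F \<omega> + e)" if e: "0 < e" for e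
  proof -
    let ?C = "A \<union> uminus ` A \<union> B \<union> uminus ` B"
    have "compact ?C"
      using AB by (intro compact_Un compact_negations) (auto simp: compact_convex_sets_def)
    then obtain F where F: "finite F" "?C \<subseteq> (\<Union>x\<in>F. ball x (e / 2))"
      using e unfolding compact_eq_totally_bounded by (metis half_gt_zero)
    have ne: "F \<noteq> {}" using F(2) AB by (auto simp: compact_convex_sets_def)
    have le: "blinfun_apply (functional \<omega>) a \<le> J F \<omega> + e / 2" if a: "a \<in> ?C" for a \<omega>
    proof -
      obtain x where x: "x \<in> F" "norm (a - x) \<le> e / 2"
        using subsetD[OF F(2) a] by (auto simp: dist_norm norm_minus_commute)
      show ?thesis
        using functional_abs_le[OF x(2), of \<omega>] J_upper[OF bounded_sets_finite[OF F(1) ne] x(1), of \<omega>]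
        unfolding blinfun.diff_right by linarith
    qed
    have J: "J C \<omega> \<le> J F \<omega> + e / 2 \<and> - (J F \<omega> + e / 2) \<le> J C \<omega>"
      if C: "C \<in> bounded_sets" "C \<union> uminus ` C \<subseteq> ?C" for C \<omega>
    proof
      show "J C \<omega> \<le> J F \<omega> + e / 2" using C by (intro J_least le) auto
      obtain c where c: "c \<in> C" using C by (auto simp: bounded_sets_def)
      then have "- blinfun_apply (functional \<omega>) c \<le> J F \<omega> + e / 2"
        using le[of "- c" \<omega>] C by (auto simp: blinfun.minus_right)
      then show "- (J F \<omega> + e / 2) \<le> J C \<omega>"
        using J_upper[OF C(1) c, of \<omega>] by linarith
    qed
    have "\<bar>(J A - J B) \<omega>\<bar> \<le> J (2 \<cdot> F) \<omega> + e" for \<omega>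
    proof -
      have "A \<union> uminus ` A \<subseteq> ?C" "B \<union> uminus ` B \<subseteq> ?C" by blast+
      from J[OF bounded(1) this(1), of \<omega>] J[OF bounded(2) this(2), of \<omega>]
      show ?thesis by (simp add: J_scale bounded_sets_finite[OF F(1) ne] abs_le_iff)
    qed
    then show ?thesis using F(1) ne by (intro exI[of _ "2 \<cdot> F"]) auto
  qed
  then show "J A - J B \<in> finitely_dominated"
    using bounded by (auto simp: finitely_dominated_def diff_in_E_C)
qed

lemma E_K_subset_E_K_ideal: "E\<^sub>K \<subseteq> E\<^sub>K_ideal"
  unfolding E\<^sub>K_ideal_def by (rule hull_subset)

lemma E_K_ideal_subset_finitely_dominated: "E\<^sub>K_ideal \<subseteq> finitely_dominated"
  unfolding E\<^sub>K_ideal_def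
  by (intro hull_minimal E_K_subset_finitely_dominated conjI closed_finitely_dominated
      lattice_ideal_finitely_dominated)

text \<open>Closed ideals are stable under nonempty intersections only, since the empty one is the
  whole of \<open>C\<^sub>b(\<Omega>)\<close>; \<open>finitely_dominated\<close> is a member of the
  family.\<close>

lemma closed_lattice_ideal_E_K_ideal:
  fixes N :: "('a::real_normed_vector dual_ball \<Rightarrow>\<^sub>C real) set"
  assumes "N = E\<^sub>K_ideal"
  shows "closed N" and "lattice_ideal N"
proof -
  have Inter: "closed (\<Inter>\<N>) \<and> lattice_ideal (\<Inter>\<N>)"
    if \<N>: "\<And>N. N \<in> \<N> \<Longrightarrow> closed N \<and> lattice_ideal N" "\<N> \<noteq> {}"
    for \<N> :: "('a dual_ball \<Rightarrow>\<^sub>C real) set set"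
  proof
    show "closed (\<Inter>\<N>)" using \<N> by (intro closed_Inter) blast
    have "subspace (\<Inter>\<N>)" using \<N> by (intro subspace_Inter) (auto simp: lattice_ideal_def)
    then show "lattice_ideal (\<Inter>\<N>)" using \<N> unfolding lattice_ideal_def by blast
  qed
  let ?\<N> = "{N :: ('a dual_ball \<Rightarrow>\<^sub>C real) set. (closed N \<and> lattice_ideal N) \<and> E\<^sub>K \<subseteq> N}"
  have "finitely_dominated \<in> ?\<N>"
    by (simp add: closed_finitely_dominated lattice_ideal_finitely_dominated
        E_K_subset_finitely_dominated)
  then have "?\<N> \<noteq> {}" by (metis empty_iff)
  then have "closed (\<Inter>?\<N>) \<and> lattice_ideal (\<Inter>?\<N>)"
    by (intro Inter) simp_all
  then have "closed N \<and> lattice_ideal N"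
    unfolding assms E\<^sub>K_ideal_def hull_def .
  then show "closed N" "lattice_ideal N" by auto
qed


section \<open>Measures of non-property \<open>\<DD>\<close>\<close>

text \<open>Let r tend to 0: what matters is that c does not depend on r. Both limit arguments for
  the measure end in this form.\<close>

lemma le_of_convex_bound:
  fixes a b c :: real
  assumes "\<And>r. 0 < r \<Longrightarrow> r < 1 \<Longrightarrow> a \<le> (1 - r) * b + r * c"
  shows "a \<le> b"
proof (rule tendsto_lowerbound)
  show "((\<lambda>r. (1 - r) * b + r * c) \<longlongrightarrow> b) (at_right 0)"
    by (auto intro!: tendsto_eq_intros)
  have "\<forall>\<^sub>F r in at_right (0::real). r \<in> {0<..<1}"
    by (rule eventually_at_right_real) simp
  then show "\<forall>\<^sub>F r in at_right 0. a \<le> (1 - r) * b + r * c"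
    by eventually_elim (use assms in auto)
qed simp

lemma mem_scale_set: "x \<in> A \<Longrightarrow> c *\<^sub>R x \<in> c \<cdot> A"
  by (rule imageI)

lemma fundamental_subsemigroupD:
  assumes "fundamental_subsemigroup \<D>"
  shows "\<exists>D\<in>\<D>. x \<in> D"
    and "A \<in> \<D> \<Longrightarrow> B \<in> \<D> \<Longrightarrow> closed_hull (A \<union> uminus ` A \<union> B \<union> uminus ` B) \<in> \<D>"
    and "D \<in> \<D> \<Longrightarrow> B \<noteq> {} \<Longrightarrow> B \<subseteq> D \<Longrightarrow> closed_hull B \<in> \<D>"
proof -
  have "\<Union>\<D> = UNIV"
    using assms by (simp add: fundamental_subsemigroup_def)
  then show "\<exists>D\<in>\<D>. x \<in> D" by blast
qed (use assms in \<open>simp_all add: fundamental_subsemigroup_def\<close>)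

text \<open>Each point lies in some member of \<D>. The symmetric hull merges a member containing x
  with the hull of F, and heredity cuts the result down to \<open>insert x F\<close>.\<close>

lemma closed_hull_finite_mem:
  assumes \<D>: "fundamental_subsemigroup \<D>" and "finite F" "F \<noteq> {}"
  shows "closed_hull F \<in> \<D>"
  using assms(2,3)
proof (induction rule: finite_ne_induct)
  case (singleton x)
  obtain D where "D \<in> \<D>" "x \<in> D" using fundamental_subsemigroupD(1)[OF \<D>] by blast
  then show ?case by (intro fundamental_subsemigroupD(3)[OF \<D> \<open>D \<in> \<D>\<close>]) simp_all
next
  case (insert x F)
  obtain D where D: "D \<in> \<D>" "x \<in> D" using fundamental_subsemigroupD(1)[OF \<D>] by blast
  let ?U = "D \<union> uminus ` D \<union> closed_hull F \<union> uminus ` closed_hull F"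
  have sub: "A \<subseteq> closed_hull A" for A :: "'a set"
    by (rule order_trans[OF hull_subset closure_subset])
  have "insert x F \<subseteq> ?U" using D(2) sub[of F] by blast
  then have "insert x F \<subseteq> closed_hull ?U" using sub[of ?U] by (rule order_trans)
  with fundamental_subsemigroupD(2)[OF \<D> D(1) insert.IH] show ?case
    by (rule fundamental_subsemigroupD(3)[OF \<D> _ insert_not_empty])
qed

section \<open>Convexity estimates for the measure\<close>

locale nonproperty =
  fixes \<D> :: "'a::real_normed_vector set set" and \<mu> :: "'a set \<Rightarrow> real"
  assumes fundamental: "fundamental_subsemigroup \<D>" and convex: "convex_measure \<D> \<mu>"
begin

abbreviation B\<^sub>X :: "'a set" where
  "B\<^sub>X \<equiv> cball 0 1"

lemma nonneg: "B \<in> bounded_sets \<Longrightarrow> 0 \<le> \<mu> B"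
  and mono: "A \<in> bounded_sets \<Longrightarrow> B \<in> bounded_sets \<Longrightarrow> B \<subseteq> A \<Longrightarrow> \<mu> B \<le> \<mu> A"
  and hull_eq: "B \<in> bounded_sets \<Longrightarrow> \<mu> (convex hull B) = \<mu> B"
  and zero_iff: "B \<in> bounded_sets \<Longrightarrow> \<mu> B = 0 \<longleftrightarrow> closed_hull B \<in> \<D>"
  using convex by (simp_all add: convex_measure_def nonproperty_measure_def)

lemma finite_zero: "finite F \<Longrightarrow> F \<noteq> {} \<Longrightarrow> \<mu> F = 0"
  by (simp add: zero_iff bounded_sets_finite closed_hull_finite_mem[OF fundamental])

lemma convex_le:
  assumes "A \<in> bounded_sets" "B \<in> bounded_sets" "0 \<le> t" "t \<le> 1"
  shows "\<mu> ((1 - t) \<cdot> A + t \<cdot> B) \<le> (1 - t) * \<mu> A + t * \<mu> B"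
proof -
  have "\<forall>t. 0 \<le> t \<and> t \<le> 1 \<longrightarrow> \<mu> (t \<cdot> A + (1 - t) \<cdot> B) \<le> t * \<mu> A + (1 - t) * \<mu> B"
    using convex assms(1,2) unfolding convex_measure_def by blast
  from this[rule_format, of "1 - t"] show ?thesis using assms(3,4) by simp
qed

lemma le_convex_combination:
  assumes "X \<in> bounded_sets" "A \<in> bounded_sets" "B \<in> bounded_sets" "0 \<le> t" "t \<le> 1"
    and "X \<subseteq> (1 - t) \<cdot> A + t \<cdot> B"
  shows "\<mu> X \<le> (1 - t) * \<mu> A + t * \<mu> B"
  using mono[OF _ assms(1,6)] convex_le[OF assms(2-5)] assms(1-3)
  by (meson bounded_sets_plus bounded_sets_scale order_trans)

text \<open>The identity a + t y = (1 - t) a + t (a + y) turns convexity into an estimate along the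
  direction of the ball. Limits in the radius and the Lipschitz constants both rest on it.\<close>

lemma plus_ball_le:
  assumes A: "A \<in> bounded_sets" and t: "0 \<le> t" "t \<le> 1"
  shows "\<mu> (A + t \<cdot> B\<^sub>X) \<le> (1 - t) * \<mu> A + t * \<mu> (A + B\<^sub>X)"
proof (rule le_convex_combination)
  show "A + t \<cdot> B\<^sub>X \<subseteq> (1 - t) \<cdot> A + t \<cdot> (A + B\<^sub>X)"
  proof
    fix x assume "x \<in> A + t \<cdot> B\<^sub>X"
    then obtain a y where x: "x = a + t *\<^sub>R y" "a \<in> A" "y \<in> B\<^sub>X"
      by (auto elim!: set_plus_elim)
    then have "x = (1 - t) *\<^sub>R a + t *\<^sub>R (a + y)" by (simp add: algebra_simps)
    then show "x \<in> (1 - t) \<cdot> A + t \<cdot> (A + B\<^sub>X)"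
      using x by (auto intro!: set_plus_intro mem_scale_set)
  qed
qed (use A t in \<open>auto intro!: bounded_sets_intros\<close>)

text \<open>Finite sets have measure \<open>0\<close>, so convexity allows to absorb a finite summand into a
  small fraction of \<open>B\<close>: with \<open>\<delta> = r/4\<close>,
  \<open>B + F + \<delta> B\<^sub>X \<subseteq> (1 - r) B + r (1/2 (2 B) + 1/2 (1/2 (4/r F) + 1/2 B\<^sub>X))\<close>.\<close>

lemma le_of_subset_plus_finite:
  assumes A: "A \<in> bounded_sets" and B: "B \<in> bounded_sets"
    and sub: "\<And>\<delta>. 0 < \<delta> \<Longrightarrow> \<exists>F. finite F \<and> F \<noteq> {} \<and> A \<subseteq> closed_hull (B + F + \<delta> \<cdot> B\<^sub>X)"
  shows "\<mu> A \<le> \<mu> B"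
proof (rule le_of_convex_bound)
  fix r :: real assume r: "0 < r" "r < 1"
  obtain F where F: "finite F" "F \<noteq> {}" and AF: "A \<subseteq> closed_hull (B + F + (r / 8) \<cdot> B\<^sub>X)"
    using sub[of "r / 8"] r by auto
  have bF: "F \<in> bounded_sets" by (rule bounded_sets_finite[OF F])
  let ?G = "(4 / r) \<cdot> F" and ?C = "B + F + (r / 8) \<cdot> B\<^sub>X + (r / 8) \<cdot> B\<^sub>X"
  have bG: "?G \<in> bounded_sets" by (rule bounded_sets_scale[OF bF])
  have bC: "?C \<in> bounded_sets" by (intro bounded_sets_intros B bF)
  \<comment> \<open>The second r/8 pays for replacing the closed hull by the hull, whose measure is
    known from \<open>hull_eq\<close>; the two together make up \<delta> = r/4.\<close>
  have "A \<subseteq> convex hull (B + F + (r / 8) \<cdot> B\<^sub>X) + (r / 8) \<cdot> B\<^sub>X"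
  proof
    fix a assume "a \<in> A"
    then have "a \<in> closure (convex hull (B + F + (r / 8) \<cdot> B\<^sub>X))" using AF by blast
    then obtain y where y: "y \<in> convex hull (B + F + (r / 8) \<cdot> B\<^sub>X)" "dist y a < r / 8"
      using r(1) unfolding closure_approachable by (meson divide_pos_pos zero_less_numeral)
    have "a = y + (r / 8) *\<^sub>R ((8 / r) *\<^sub>R (a - y))" using r by simp
    moreover have "(8 / r) *\<^sub>R (a - y) \<in> B\<^sub>X"
      using y(2) r unfolding mem_cball_0 norm_scaleR
      by (simp add: dist_norm norm_minus_commute field_simps)
    ultimately show "a \<in> convex hull (B + F + (r / 8) \<cdot> B\<^sub>X) + (r / 8) \<cdot> B\<^sub>X"
      using y(1) by (metis mem_scale_set set_plus_intro)
  qed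
  also have "\<dots> \<subseteq> convex hull ?C"
    unfolding convex_hull_set_plus[of _ "(r / 8) \<cdot> B\<^sub>X"]
    by (intro set_plus_mono2 hull_subset order_refl)
  finally have "\<mu> A \<le> \<mu> ?C"
    using mono[OF bounded_sets_hull[OF bC] A] hull_eq[OF bC] by simp
  also have "\<dots> \<le> (1 - r) * \<mu> B + r * \<mu> ((1 - 1/2) \<cdot> (2 \<cdot> B) + (1/2) \<cdot> ((1 - 1/2) \<cdot> ?G + (1/2) \<cdot> B\<^sub>X))"
  proof (rule le_convex_combination[OF bC B])
    show "?C \<subseteq> (1 - r) \<cdot> B + r \<cdot> ((1 - 1/2) \<cdot> (2 \<cdot> B) + (1/2) \<cdot> ((1 - 1/2) \<cdot> ?G + (1/2) \<cdot> B\<^sub>X))"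
    proof
      fix x assume "x \<in> ?C"
      then obtain b f y z where x: "x = b + f + (r / 8) *\<^sub>R y + (r / 8) *\<^sub>R z"
        and mem: "b \<in> B" "f \<in> F" "y \<in> B\<^sub>X" "z \<in> B\<^sub>X"
        by (auto elim!: set_plus_elim)
      have m: "(1/2) *\<^sub>R (y + z) \<in> B\<^sub>X"
        using norm_triangle_ineq[of y z] mem by simp
      have "x = (1 - r) *\<^sub>R b + r *\<^sub>R ((1 - 1/2) *\<^sub>R (2 *\<^sub>R b)
          + (1/2) *\<^sub>R ((1 - 1/2) *\<^sub>R ((4 / r) *\<^sub>R f) + (1/2) *\<^sub>R ((1/2) *\<^sub>R (y + z))))"
        using r by (simp add: x algebra_simps)
      then show "x \<in> (1 - r) \<cdot> B + r \<cdot> ((1 - 1/2) \<cdot> (2 \<cdot> B) + (1/2) \<cdot> ((1 - 1/2) \<cdot> ?G + (1/2) \<cdot> B\<^sub>X))"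
        using mem m by (simp only: set_plus_intro mem_scale_set)
    qed
  qed (use r in \<open>auto intro!: bounded_sets_intros B bF\<close>)
  also have "\<mu> ((1 - 1/2) \<cdot> (2 \<cdot> B) + (1/2) \<cdot> ((1 - 1/2) \<cdot> ?G + (1/2) \<cdot> B\<^sub>X))
      \<le> (1 - 1/2) * \<mu> (2 \<cdot> B) + (1/2) * \<mu> ((1 - 1/2) \<cdot> ?G + (1/2) \<cdot> B\<^sub>X)"
    by (intro convex_le bounded_sets_plus bounded_sets_scale bounded_sets_ball B bG) auto
  also have "\<mu> ((1 - 1/2) \<cdot> ?G + (1/2) \<cdot> B\<^sub>X) \<le> (1 - 1/2) * \<mu> ?G + (1/2) * \<mu> B\<^sub>X"
    by (intro convex_le bG bounded_sets_ball) auto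
  \<comment> \<open>Here the factor 4/r, unbounded as r tends to 0, costs nothing, and the remaining
    bound no longer involves F.\<close>
  also have "\<mu> ?G = 0" using F by (intro finite_zero) auto
  finally show "\<mu> A \<le> (1 - r) * \<mu> B + r * ((1/2) * \<mu> (2 \<cdot> B) + (1/4) * \<mu> B\<^sub>X)"
    using r by (simp add: mult_left_mono)
qed

text \<open>Enlarging the radius from c to c + r amounts to adding at most r times the ball, whose
  effect vanishes with r by \<open>plus_ball_le\<close>.\<close>

lemma le_plus_ball_limit:
  assumes B: "B \<in> bounded_sets" and c: "\<And>c'. c < c' \<Longrightarrow> a \<le> \<mu> (B + c' \<cdot> B\<^sub>X)"
  shows "a \<le> \<mu> (B + c \<cdot> B\<^sub>X)"
proof (rule le_of_convex_bound)
  fix r :: real assume r: "0 < r" "r < 1"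
  have C: "B + c \<cdot> B\<^sub>X \<in> bounded_sets" by (intro bounded_sets_intros B)
  have "B + (c + r) \<cdot> B\<^sub>X \<subseteq> B + c \<cdot> B\<^sub>X + r \<cdot> B\<^sub>X"
  proof
    fix x assume "x \<in> B + (c + r) \<cdot> B\<^sub>X"
    then obtain b y where "x = b + c *\<^sub>R y + r *\<^sub>R y" "b \<in> B" "y \<in> B\<^sub>X"
      by (auto elim!: set_plus_elim simp: algebra_simps)
    then show "x \<in> B + c \<cdot> B\<^sub>X + r \<cdot> B\<^sub>X" by (simp only: set_plus_intro mem_scale_set)
  qed
  then have "\<mu> (B + (c + r) \<cdot> B\<^sub>X) \<le> \<mu> (B + c \<cdot> B\<^sub>X + r \<cdot> B\<^sub>X)"
    by (intro mono bounded_sets_intros B)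
  with c[of "c + r"] plus_ball_le[OF C, of r] r
  show "a \<le> (1 - r) * \<mu> (B + c \<cdot> B\<^sub>X) + r * \<mu> (B + c \<cdot> B\<^sub>X + B\<^sub>X)"
    by simp
qed

text \<open>On the unit sphere a constant \<open>c\<close> agrees with \<open>J (c B\<^sub>X)\<close>, so by homogeneity a bound up to a
  constant is a bound by the support function of \<open>B + c B\<^sub>X\<close>.\<close>

lemma le_of_J_le:
  assumes A: "A \<in> bounded_sets" and B: "B \<in> bounded_sets" and c: "0 \<le> c"
    and le: "\<And>c'. c < c' \<Longrightarrow> \<exists>n\<in>finitely_dominated. \<forall>\<omega>. J A \<omega> + n \<omega> \<le> J B \<omega> + c'"
  shows "\<mu> A \<le> \<mu> (B + c \<cdot> B\<^sub>X)"
proof (rule le_plus_ball_limit[OF B], rule le_of_subset_plus_finite[OF A])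
  fix c' assume c': "c < c'"
  show BC: "B + c' \<cdot> B\<^sub>X \<in> bounded_sets" by (intro bounded_sets_intros B)
  fix \<delta> :: real assume \<delta>: "0 < \<delta>"
  obtain n where n: "n \<in> finitely_dominated" "\<And>\<omega>. J A \<omega> + n \<omega> \<le> J B \<omega> + c'"
    using le[OF c'] by blast
  obtain F where F: "finite F" "F \<noteq> {}" "\<And>\<omega>. \<bar>n \<omega>\<bar> \<le> J F \<omega> + \<delta>"
    using finitely_dominatedD[OF n(1) \<delta>] by blast
  have bF: "F \<in> bounded_sets" by (rule bounded_sets_finite[OF F(1,2)])
  let ?C = "B + c' \<cdot> B\<^sub>X + F + \<delta> \<cdot> B\<^sub>X"
  have C: "?C \<in> bounded_sets" by (intro bounded_sets_plus bounded_sets_scale bounded_sets_ball B bF)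
  have JC: "J ?C = J B + c' *\<^sub>R J B\<^sub>X + J F + \<delta> *\<^sub>R J B\<^sub>X"
    using c c' \<delta> by (simp add: J_plus J_scale bounded_sets_plus bounded_sets_scale bounded_sets_ball B bF)
  have "(J A - J ?C) \<omega> \<le> 0" for \<omega>
  proof (rule E_C_nonpos_of_sphere[OF diff_in_E_C[OF A C]])
    fix \<omega> :: "'a dual_ball" assume "norm (functional \<omega>) = 1"
    then show "(J A - J ?C) \<omega> \<le> 0"
      using n(2)[of \<omega>] F(3)[of \<omega>] by (simp add: JC J_ball)
  qed
  then have JAC: "J A \<omega> \<le> J ?C \<omega>" for \<omega> by simp
  \<comment> \<open>A point outside would be separated by some \<omega> with a gap e, contradicting
    the inequality of support functions at \<omega>.\<close>
  have "a \<in> closed_hull ?C" if a: "a \<in> A" for a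
  proof (rule ccontr)
    assume "a \<notin> closed_hull ?C"
    moreover have "convex hull ?C \<noteq> {}" using C by (simp add: bounded_sets_def)
    ultimately obtain \<omega> e where e: "0 < e"
      "\<And>c. c \<in> convex hull ?C \<Longrightarrow> blinfun_apply (functional \<omega>) c + e \<le> blinfun_apply (functional \<omega>) a"
      using separate_point_convex[OF convex_convex_hull, of ?C a] by blast
    have "blinfun_apply (functional \<omega>) x \<le> blinfun_apply (functional \<omega>) a - e" if "x \<in> ?C" for x
      using e(2)[OF hull_inc[OF that]] by simp
    then have "J ?C \<omega> \<le> blinfun_apply (functional \<omega>) a - e" by (rule J_least[OF C])
    then show False using J_upper[OF A a, of \<omega>] JAC[of \<omega>] e(1) by linarith
  qed
  then show "\<exists>F. finite F \<and> F \<noteq> {} \<and> A \<subseteq> closed_hull (B + c' \<cdot> B\<^sub>X + F + \<delta> \<cdot> B\<^sub>X)"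
    using F(1,2) by blast
qed

end


section \<open>The representing function\<close>

text \<open>Both \<open>E\<^sub>K\<close> and \<open>E\<^sub>K_ideal\<close> satisfy the two
  inclusions. The lower one makes translations by points vanish in the quotient, which gives
  positivity; the upper one makes the measure blind to N.\<close>

locale quotient_isometry =
  fixes N :: "('a::real_normed_vector dual_ball \<Rightarrow>\<^sub>C real) set"
    and K :: "'k topology" and T :: "('a dual_ball \<Rightarrow>\<^sub>C real) set \<Rightarrow> 'k \<Rightarrow> real"
  assumes E_K_subset: "E\<^sub>K \<subseteq> N" and N_subset: "N \<subseteq> finitely_dominated"
    and isometry: "order_isometry_into_C N K T"
begin

abbreviation \<T> :: "'a set \<Rightarrow> 'k \<Rightarrow> real" where
  "\<T> \<equiv> TQJ N T"

lemma T_plus: "u \<in> E\<^sub>C \<Longrightarrow> v \<in> E\<^sub>C \<Longrightarrow> T ((u + v) +o N) = (\<lambda>x. T (u +o N) x + T (v +o N) x)"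
  and T_scale: "u \<in> E\<^sub>C \<Longrightarrow> T ((c *\<^sub>R u) +o N) = (\<lambda>x. c * T (u +o N) x)"
  and T_norm: "u \<in> E\<^sub>C \<Longrightarrow> C_norm K (T (u +o N)) = coset_norm (u +o N)"
  and T_le: "u \<in> E\<^sub>C \<Longrightarrow> v \<in> E\<^sub>C \<Longrightarrow> coset_le (u +o N) (v +o N) \<longleftrightarrow> T (u +o N) \<le> T (v +o N)"
  and T_mem: "u \<in> E\<^sub>C \<Longrightarrow> T (u +o N) \<in> C_space K"
  using isometry by (auto simp: order_isometry_into_C_def quotient_space_def)

lemma \<T>_plus:
  "A \<in> bounded_sets \<Longrightarrow> B \<in> bounded_sets \<Longrightarrow> \<T> (A + B) = (\<lambda>x. \<T> A x + \<T> B x)"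
  by (simp add: TQJ_def J_plus T_plus J_in_E_C)

lemma \<T>_scale: "A \<in> bounded_sets \<Longrightarrow> 0 \<le> c \<Longrightarrow> \<T> (c \<cdot> A) = (\<lambda>x. c * \<T> A x)"
  by (simp add: TQJ_def J_scale T_scale J_in_E_C)

text \<open>Translate so that 0 belongs to the set: its support function becomes nonnegative, and
  the class modulo N is unchanged because \<open>J {0} - J {b}\<close> lies in N.\<close>

lemma \<T>_nonneg:
  assumes B: "B \<in> bounded_sets"
  shows "0 \<le> \<T> B x"
proof -
  obtain b where b: "b \<in> B" using B by (auto simp: bounded_sets_def)
  have E: "0 \<in> E\<^sub>C" by (rule subspace_0[OF subspace_E_C])
  have "0 \<in> N" "J {0} - J {b} \<in> N"
    using E_K_subset zero_in_E_K diff_in_E_K by auto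
  moreover have "apply_bcontfun (0 + 0) \<omega> \<le> (J B + (J {0} - J {b})) \<omega>" for \<omega>
    using J_upper[OF B b, of \<omega>] by (simp add: J_singleton)
  ultimately have "coset_le (0 +o N) (J B +o N)"
    unfolding coset_le_def by (meson set_plus_intro2)
  then have "T (0 +o N) \<le> \<T> B"
    using T_le[OF E J_in_E_C[OF B]] by (simp add: TQJ_def)
  moreover have "T (0 +o N) = (\<lambda>x. 0)"
    using T_scale[OF E, of 0] by simp
  ultimately show ?thesis by (simp add: le_fun_def)
qed

lemma cone_range: "cone_in_C_pos K (\<T> ` bounded_sets)"
  unfolding cone_in_C_pos_def
proof (intro conjI ballI allI impI)
  show "\<T> ` bounded_sets \<subseteq> {f \<in> C_space K. \<forall>x. 0 \<le> f x}"
    using \<T>_nonneg T_mem J_in_E_C by (auto simp: TQJ_def)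
  fix f assume "f \<in> \<T> ` bounded_sets"
  then obtain A where A: "A \<in> bounded_sets" "f = \<T> A" by blast
  show "(\<lambda>x. f x + g x) \<in> \<T> ` bounded_sets" if g: "g \<in> \<T> ` bounded_sets" for g
  proof -
    obtain B where "B \<in> bounded_sets" "g = \<T> B" using g by blast
    then show ?thesis
      using A by (intro image_eqI[of _ _ "A + B"]) (auto simp: \<T>_plus bounded_sets_plus)
  qed
  show "(\<lambda>x. c * f x) \<in> \<T> ` bounded_sets" if "0 \<le> c" for c
    using A that by (intro image_eqI[of _ _ "c \<cdot> A"]) (auto simp: \<T>_scale bounded_sets_scale)
qed

lemma J_le_of_\<T>_le:
  assumes AB: "A \<in> bounded_sets" "B \<in> bounded_sets" and le: "\<T> A \<le> \<T> B"
  shows "\<exists>n\<in>finitely_dominated. \<forall>\<omega>. J A \<omega> + n \<omega> \<le> J B \<omega>"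
proof -
  have "coset_le (J A +o N) (J B +o N)"
    using T_le AB le by (simp add: TQJ_def J_in_E_C)
  then obtain n m where nm: "n \<in> N" "m \<in> N" "\<And>\<omega>. (J A + n) \<omega> \<le> (J B + m) \<omega>"
    unfolding coset_le_def elt_set_plus_def by blast
  then have "n - m \<in> finitely_dominated"
    using N_subset by (intro subspace_diff[OF subspace_finitely_dominated]) auto
  moreover have "J A \<omega> + (n - m) \<omega> \<le> J B \<omega>" for \<omega>
    using nm(3)[of \<omega>] by simp
  ultimately show ?thesis by blast
qed

lemma C_norm_\<T>_diff:
  assumes A: "A \<in> bounded_sets" and B: "B \<in> bounded_sets"
  shows "C_norm K (\<lambda>x. \<T> A x - \<T> B x) = (INF n\<in>N. norm (J A - J B + n))"
proof -
  have "J A + (- 1) *\<^sub>R J B \<in> E\<^sub>C"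
    by (intro subspace_add[OF subspace_E_C] subspace_scale[OF subspace_E_C] J_in_E_C A B)
  moreover have "T ((J A + (- 1) *\<^sub>R J B) +o N) = (\<lambda>x. \<T> A x - \<T> B x)"
    using T_plus[OF J_in_E_C[OF A] subspace_scale[OF subspace_E_C J_in_E_C[OF B]], of "- 1"]
      T_scale[OF J_in_E_C[OF B], of "- 1"] by (simp add: TQJ_def)
  ultimately have "C_norm K (\<lambda>x. \<T> A x - \<T> B x) = coset_norm ((J A - J B) +o N)"
    using T_norm[of "J A + (- 1) *\<^sub>R J B"] by simp
  moreover have "(J A - J B) +o N = (\<lambda>n. J A - J B + n) ` N"
    by (auto simp: elt_set_plus_def)
  ultimately show ?thesis by (simp add: coset_norm_def image_image)
qed

text \<open>The quotient norm is an infimum that need not be attained, so a representative is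
  available only for c strictly above it. This is why \<open>le_of_J_le\<close> assumes its bound
  for all larger constants.\<close>

lemma J_le_of_C_norm_less:
  assumes A: "A \<in> bounded_sets" and B: "B \<in> bounded_sets"
    and less: "C_norm K (\<lambda>x. \<T> A x - \<T> B x) < c"
  shows "\<exists>n\<in>finitely_dominated. \<forall>\<omega>. J A \<omega> + n \<omega> \<le> J B \<omega> + c"
proof -
  have "N \<noteq> {}" using E_K_subset zero_in_E_K by blast
  moreover have "bdd_below ((\<lambda>n. norm (J A - J B + n)) ` N)"
    by (rule bdd_belowI2[where m = 0]) simp
  ultimately obtain n where n: "n \<in> N" "norm (J A - J B + n) < c"
    using less by (auto simp: C_norm_\<T>_diff[OF A B] cINF_less_iff)
  have "J A \<omega> + n \<omega> \<le> J B \<omega> + c" for \<omega>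
    using norm_bounded[of "J A - J B + n" \<omega>] n(2) by simp
  then show ?thesis using n(1) N_subset by blast
qed

lemma C_norm_\<T>_diff_nonneg:
  assumes "A \<in> bounded_sets" "B \<in> bounded_sets"
  shows "0 \<le> C_norm K (\<lambda>x. \<T> A x - \<T> B x)"
  unfolding C_norm_\<T>_diff[OF assms] using E_K_subset zero_in_E_K
  by (intro cINF_greatest) auto

lemma \<T>_zero: "\<T> {0} = (\<lambda>x. 0)"
  using \<T>_scale[of "{0}" 0] by (simp add: bounded_sets_finite)

lemma J_zero: "J {0} = 0"
  by (rule bcontfun_eqI) (simp add: J_singleton)

lemma J_le_of_\<T>_norm_less:
  assumes "A \<in> bounded_sets" "C_norm K (\<T> A) < c"
  shows "\<exists>n\<in>finitely_dominated. \<forall>\<omega>. J A \<omega> + n \<omega> \<le> c"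
  using J_le_of_C_norm_less[OF assms(1), of "{0}" c] assms(2)
  by (simp add: bounded_sets_finite \<T>_zero J_zero)

end

section \<open>Transfer of order and norm estimates to the measure\<close>

locale nonproperty_quotient = nonproperty \<D> \<mu> + quotient_isometry N K T
  for \<D> :: "'a::real_normed_vector set set" and \<mu> and N :: "('a dual_ball \<Rightarrow>\<^sub>C real) set"
    and K :: "'k topology" and T
begin

text \<open>This is the case of radius 0. It yields both the well-definedness and the monotonicity
  of the representing function.\<close>

lemma \<mu>_mono_\<T>:
  assumes AB: "A \<in> bounded_sets" "B \<in> bounded_sets" and le: "\<T> A \<le> \<T> B"
  shows "\<mu> A \<le> \<mu> B"
proof -
  obtain n where n: "n \<in> finitely_dominated" "\<And>\<omega>. J A \<omega> + n \<omega> \<le> J B \<omega>"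
    using J_le_of_\<T>_le[OF AB le] by blast
  have "\<mu> A \<le> \<mu> (B + 0 \<cdot> B\<^sub>X)"
  proof (rule le_of_J_le[OF AB order_refl])
    fix c :: real assume "0 < c"
    then have "J A \<omega> + n \<omega> \<le> J B \<omega> + c" for \<omega> using n(2)[of \<omega>] by linarith
    then show "\<exists>n\<in>finitely_dominated. \<forall>\<omega>. J A \<omega> + n \<omega> \<le> J B \<omega> + c"
      using n(1) by blast
  qed
  also have "0 \<cdot> B\<^sub>X = {0}" by (auto intro!: image_eqI[of _ _ 0])
  also have "B + {0} = B" by (auto simp: set_plus_def)
  finally show ?thesis .
qed

lemma \<mu>_le_ball:
  assumes A: "A \<in> bounded_sets" and r: "0 \<le> r" and norm: "C_norm K (\<T> A) \<le> r"
  shows "\<mu> A \<le> \<mu> (r \<cdot> B\<^sub>X)"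
proof -
  have "\<mu> A \<le> \<mu> ({0} + r \<cdot> B\<^sub>X)"
    using J_le_of_\<T>_norm_less[OF A] norm
    by (intro le_of_J_le A r) (auto simp: bounded_sets_finite J_zero)
  also have "{0} + r \<cdot> B\<^sub>X = r \<cdot> B\<^sub>X" by (auto simp: set_plus_def)
  finally show ?thesis .
qed

text \<open>Origin of the constant 1 + r: modulo N the set A is no larger than r times the ball, and
  one more copy of the ball is added for the convexity estimate.\<close>

lemma \<mu>_plus_ball_le:
  assumes A: "A \<in> bounded_sets" and r: "0 \<le> r" and norm: "C_norm K (\<T> A) \<le> r"
  shows "\<mu> (A + B\<^sub>X) \<le> \<mu> ((1 + r) \<cdot> B\<^sub>X)"
proof -
  have "\<mu> (A + B\<^sub>X) \<le> \<mu> (B\<^sub>X + r \<cdot> B\<^sub>X)"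
  proof (rule le_of_J_le)
    fix c assume "r < c"
    then obtain n where n: "n \<in> finitely_dominated" "\<And>\<omega>. J A \<omega> + n \<omega> \<le> c"
      using J_le_of_\<T>_norm_less[OF A, of c] norm by auto
    have "J (A + B\<^sub>X) \<omega> + n \<omega> \<le> J B\<^sub>X \<omega> + c" for \<omega>
      using n(2)[of \<omega>] by (simp add: J_plus A bounded_sets_ball)
    then show "\<exists>n\<in>finitely_dominated. \<forall>\<omega>. J (A + B\<^sub>X) \<omega> + n \<omega> \<le> J B\<^sub>X \<omega> + c"
      using n(1) by blast
  qed (intro bounded_sets_intros A r)+
  also have "B\<^sub>X + r \<cdot> B\<^sub>X \<subseteq> (1 + r) \<cdot> B\<^sub>X"
  proof
    fix x assume "x \<in> B\<^sub>X + r \<cdot> B\<^sub>X"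
    then obtain y z where x: "x = y + r *\<^sub>R z" "y \<in> B\<^sub>X" "z \<in> B\<^sub>X"
      by (auto elim!: set_plus_elim)
    have "norm x \<le> norm y + r * norm z"
      using norm_triangle_ineq[of y "r *\<^sub>R z"] x r by simp
    also have "\<dots> \<le> 1 + r * 1"
      using x r by (intro add_mono mult_left_mono) auto
    finally have "inverse (1 + r) *\<^sub>R x \<in> B\<^sub>X"
      using r by (simp add: field_simps)
    then have "(1 + r) *\<^sub>R inverse (1 + r) *\<^sub>R x \<in> (1 + r) \<cdot> B\<^sub>X" by (rule mem_scale_set)
    then show "x \<in> (1 + r) \<cdot> B\<^sub>X" using r by simp
  qed
  then have "\<mu> (B\<^sub>X + r \<cdot> B\<^sub>X) \<le> \<mu> ((1 + r) \<cdot> B\<^sub>X)"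
    by (intro mono bounded_sets_intros)
  finally show ?thesis .
qed

lemma \<mu>_le_plus_ball:
  assumes AB: "A \<in> bounded_sets" "B \<in> bounded_sets"
  shows "\<mu> A \<le> \<mu> (B + C_norm K (\<lambda>x. \<T> A x - \<T> B x) \<cdot> B\<^sub>X)"
  by (intro le_of_J_le AB C_norm_\<T>_diff_nonneg J_le_of_C_norm_less)

lemma C_norm_\<T>_diff_commute:
  "C_norm K (\<lambda>x. \<T> A x - \<T> B x) = C_norm K (\<lambda>x. \<T> B x - \<T> A x)"
  by (simp add: C_norm_def abs_minus_commute)

text \<open>If the distance \<delta> is at most 1, it serves as the convexity parameter in
  \<open>plus_ball_le\<close>. Beyond 1 that is impossible, but then the bound on
  \<open>\<mu> A\<close> alone suffices.\<close>

lemma \<mu>_diff_le: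
  assumes A: "A \<in> bounded_sets" and B: "B \<in> bounded_sets" and r: "0 \<le> r"
    and norm: "C_norm K (\<T> A) \<le> r" "C_norm K (\<T> B) \<le> r"
  shows "\<mu> A - \<mu> B \<le> \<mu> ((1 + r) \<cdot> B\<^sub>X) * C_norm K (\<lambda>x. \<T> A x - \<T> B x)"
proof -
  let ?M = "\<mu> ((1 + r) \<cdot> B\<^sub>X)"
  define \<delta> where "\<delta> = C_norm K (\<lambda>x. \<T> A x - \<T> B x)"
  have \<delta>: "0 \<le> \<delta>" unfolding \<delta>_def by (rule C_norm_\<T>_diff_nonneg[OF A B])
  have nonneg: "0 \<le> ?M" "0 \<le> \<mu> B"
    by (intro nonneg bounded_sets_intros B)+
  have plus: "\<mu> (C + B\<^sub>X) \<le> ?M" if "C \<in> bounded_sets" "C_norm K (\<T> C) \<le> r" for C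
    by (rule \<mu>_plus_ball_le[OF that(1) r that(2)])
  show ?thesis unfolding \<delta>_def[symmetric]
  proof (cases "\<delta> \<le> 1")
    case True
    have "\<mu> A \<le> (1 - \<delta>) * \<mu> B + \<delta> * \<mu> (B + B\<^sub>X)"
      using \<mu>_le_plus_ball[OF A B] plus_ball_le[OF B \<delta> True] by (simp add: \<delta>_def)
    also have "\<dots> \<le> (1 - \<delta>) * \<mu> B + \<delta> * ?M"
      using plus[OF B norm(2)] \<delta> by (simp add: mult_left_mono)
    also have "\<dots> \<le> \<mu> B + \<delta> * ?M"
      using \<delta> nonneg(2) by (simp add: algebra_simps)
    finally show "\<mu> A - \<mu> B \<le> ?M * \<delta>" by (simp add: mult.commute)
  next
    case False
    have "A \<subseteq> A + B\<^sub>X"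
    proof
      fix x assume "x \<in> A"
      then have "x + 0 \<in> A + B\<^sub>X" by (intro set_plus_intro) auto
      then show "x \<in> A + B\<^sub>X" by simp
    qed
    then have "\<mu> A \<le> \<mu> (A + B\<^sub>X)"
      by (intro mono bounded_sets_intros A)
    also have "\<dots> \<le> ?M * 1" using plus[OF A norm(1)] by simp
    also have "\<dots> \<le> ?M * \<delta>"
      using False nonneg(1) by (intro mult_left_mono) auto
    finally show "\<mu> A - \<mu> B \<le> ?M * \<delta>" using nonneg(2) by simp
  qed
qed

text \<open>Subadditivity splits off the ball of radius \<delta> and homogeneity extracts \<delta>,
  so neither a convexity parameter nor a dependence on r appears.\<close>

lemma \<mu>_diff_le_sublinear:
  assumes A: "A \<in> bounded_sets" and B: "B \<in> bounded_sets" and sub: "sublinear_measure \<D> \<mu>"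
  shows "\<mu> A - \<mu> B \<le> \<mu> B\<^sub>X * C_norm K (\<lambda>x. \<T> A x - \<T> B x)"
proof -
  let ?\<delta> = "C_norm K (\<lambda>x. \<T> A x - \<T> B x)"
  have \<delta>: "0 \<le> ?\<delta>" by (rule C_norm_\<T>_diff_nonneg[OF A B])
  have add: "\<mu> (C + D) \<le> \<mu> C + \<mu> D" if "C \<in> bounded_sets" "D \<in> bounded_sets" for C D
    using sub that by (simp add: sublinear_measure_def)
  have scale: "\<mu> (k \<cdot> C) = k * \<mu> C" if "C \<in> bounded_sets" "0 \<le> k" for C k
    using sub that by (simp add: sublinear_measure_def)
  have "\<mu> A \<le> \<mu> B + \<mu> (?\<delta> \<cdot> B\<^sub>X)"
    by (intro order_trans[OF \<mu>_le_plus_ball[OF A B]] add bounded_sets_intros B)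
  then show ?thesis
    using scale[OF bounded_sets_ball \<delta>] by (simp add: mult.commute)
qed

lemma representing_function:
  defines "V \<equiv> \<T> ` bounded_sets"
  shows "\<exists>F :: ('k \<Rightarrow> real) \<Rightarrow> real.
    (\<forall>B\<in>bounded_sets. \<mu> B = F (\<T> B)) \<and>
    (\<forall>f\<in>V. 0 \<le> F f) \<and>
    (\<forall>f\<in>V. \<forall>g\<in>V. \<forall>t. 0 \<le> t \<and> t \<le> 1 \<longrightarrow>
       F (\<lambda>x. t * f x + (1 - t) * g x) \<le> t * F f + (1 - t) * F g) \<and>
    (\<forall>f\<in>V. \<forall>g\<in>V. f \<le> g \<longrightarrow> F f \<le> F g) \<and>
    (\<forall>r\<ge>0. \<forall>f\<in>V. C_norm K f \<le> r \<longrightarrow> \<bar>F f\<bar> \<le> F (\<lambda>x. r * \<T> B\<^sub>X x)) \<and>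
    (\<forall>r\<ge>0. F (\<lambda>x. (1 + r) * \<T> B\<^sub>X x) = \<mu> ((1 + r) \<cdot> B\<^sub>X) \<and>
       (\<forall>f\<in>V. \<forall>g\<in>V. C_norm K f \<le> r \<and> C_norm K g \<le> r \<longrightarrow>
          \<bar>F f - F g\<bar> \<le> F (\<lambda>x. (1 + r) * \<T> B\<^sub>X x) * C_norm K (\<lambda>x. f x - g x))) \<and>
    (sublinear_measure \<D> \<mu> \<longrightarrow>
       (\<forall>r\<ge>0. \<forall>f\<in>V. \<forall>g\<in>V. C_norm K f \<le> r \<and> C_norm K g \<le> r \<longrightarrow>
          \<bar>F f - F g\<bar> \<le> \<mu> B\<^sub>X * C_norm K (\<lambda>x. f x - g x)))"
proof -
  \<comment> \<open>The choice of B is immaterial: sets with equal images are comparable both ways,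
    hence have equal measure. Off the cone the value of F is arbitrary.\<close>
  define F where "F f = \<mu> (SOME B. B \<in> bounded_sets \<and> \<T> B = f)" for f
  have F: "F (\<T> B) = \<mu> B" if "B \<in> bounded_sets" for B
  proof -
    let ?C = "SOME C. C \<in> bounded_sets \<and> \<T> C = \<T> B"
    have "?C \<in> bounded_sets \<and> \<T> ?C = \<T> B"
      by (rule someI[of _ B]) (use that in simp)
    then have "\<mu> ?C = \<mu> B"
      using that by (intro antisym \<mu>_mono_\<T>) auto
    then show ?thesis by (simp add: F_def)
  qed
  have F_ball: "F (\<lambda>x. r * \<T> B\<^sub>X x) = \<mu> (r \<cdot> B\<^sub>X)" if "0 \<le> r" for r
    using F[OF bounded_sets_scale[OF bounded_sets_ball], of r] that
    by (simp add: \<T>_scale bounded_sets_ball)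
  show ?thesis
    unfolding V_def ball_simps(9)
  proof (intro exI[of _ F] conjI ballI allI impI; (elim conjE)?)
    show "\<mu> B = F (\<T> B)" if "B \<in> bounded_sets" for B
      by (simp add: F that)
    show "0 \<le> F (\<T> A)" if "A \<in> bounded_sets" for A
      by (simp add: F nonneg that)
    show "F (\<lambda>x. t * \<T> A x + (1 - t) * \<T> B x) \<le> t * F (\<T> A) + (1 - t) * F (\<T> B)"
      if "A \<in> bounded_sets" "B \<in> bounded_sets" "0 \<le> t" "t \<le> 1" for A B t
      using F[of "t \<cdot> A + (1 - t) \<cdot> B"] convex_le[of A B "1 - t"] that
      by (simp add: \<T>_plus \<T>_scale F bounded_sets_plus bounded_sets_scale)
    show "F (\<T> A) \<le> F (\<T> B)" if "A \<in> bounded_sets" "B \<in> bounded_sets" "\<T> A \<le> \<T> B" for A B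
      using \<mu>_mono_\<T>[OF that] by (simp add: F that)
    show "\<bar>F (\<T> A)\<bar> \<le> F (\<lambda>x. r * \<T> B\<^sub>X x)"
      if "0 \<le> r" "A \<in> bounded_sets" "C_norm K (\<T> A) \<le> r" for r A
      using \<mu>_le_ball[OF that(2,1,3)] nonneg[OF that(2)] by (simp add: F F_ball that)
    show "F (\<lambda>x. (1 + r) * \<T> B\<^sub>X x) = \<mu> ((1 + r) \<cdot> B\<^sub>X)" if "0 \<le> r" for r
      using that by (simp add: F_ball)
    show "\<bar>F (\<T> A) - F (\<T> B)\<bar>
        \<le> F (\<lambda>x. (1 + r) * \<T> B\<^sub>X x) * C_norm K (\<lambda>x. \<T> A x - \<T> B x)"
      if r: "0 \<le> r" and AB: "A \<in> bounded_sets" "B \<in> bounded_sets"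
        and norm: "C_norm K (\<T> A) \<le> r" "C_norm K (\<T> B) \<le> r" for r A B
      using \<mu>_diff_le[OF AB r norm] \<mu>_diff_le[OF AB(2,1) r norm(2,1)] r
      by (simp add: F AB F_ball C_norm_\<T>_diff_commute[of B A] abs_le_iff)
    show "\<bar>F (\<T> A) - F (\<T> B)\<bar> \<le> \<mu> B\<^sub>X * C_norm K (\<lambda>x. \<T> A x - \<T> B x)"
      if sub: "sublinear_measure \<D> \<mu>" and AB: "A \<in> bounded_sets" "B \<in> bounded_sets" for A B
      using \<mu>_diff_le_sublinear[OF AB sub] \<mu>_diff_le_sublinear[OF AB(2,1) sub]
      by (simp add: F AB C_norm_\<T>_diff_commute[of B A] abs_le_iff)
  qed
qed

end


section \<open>Representation of the quotient by continuous functions\<close>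

lemma apply_bcontfun_sum:
  fixes f :: "'i \<Rightarrow> 'a::topological_space \<Rightarrow>\<^sub>C 'b::real_normed_vector"
  shows "apply_bcontfun (sum f I) x = (\<Sum>i\<in>I. f i x)"
  using bounded_linear.linear[OF bounded_linear_apply_bcontfun] by (rule linear_sum)

definition lattice_homs :: "(('a::topological_space \<Rightarrow>\<^sub>C real) \<Rightarrow> real) set" where
  "lattice_homs = {\<phi>. (\<forall>u v. \<phi> (u + v) = \<phi> u + \<phi> v) \<and> (\<forall>c u. \<phi> (c *\<^sub>R u) = c * \<phi> u) \<and>
     (\<forall>u. \<phi> (babs u) = \<bar>\<phi> u\<bar>) \<and> (\<forall>u. \<bar>\<phi> u\<bar> \<le> norm u)}"

definition annihilating_homs ::
    "('a::topological_space \<Rightarrow>\<^sub>C real) set \<Rightarrow> (('a \<Rightarrow>\<^sub>C real) \<Rightarrow> real) set" where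
  "annihilating_homs N = lattice_homs \<inter> {\<phi>. \<forall>n\<in>N. \<phi> n = 0}"

lemma annihilating_homs_zero: "\<phi> \<in> annihilating_homs N \<Longrightarrow> n \<in> N \<Longrightarrow> \<phi> n = 0"
  by (simp add: annihilating_homs_def)

lemma
  assumes "\<phi> \<in> annihilating_homs N"
  shows hom_add: "\<phi> (u + v) = \<phi> u + \<phi> v"
    and hom_scale: "\<phi> (c *\<^sub>R u) = c * \<phi> u"
    and hom_babs: "\<phi> (babs u) = \<bar>\<phi> u\<bar>"
    and hom_le_norm: "\<bar>\<phi> u\<bar> \<le> norm u"
  using assms by (simp_all add: annihilating_homs_def lattice_homs_def)

lemma hom_diff: "\<phi> \<in> annihilating_homs N \<Longrightarrow> \<phi> (u - v) = \<phi> u - \<phi> v"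
  using hom_add[of \<phi> N "u - v" v] by simp

lemma hom_uminus: "\<phi> \<in> annihilating_homs N \<Longrightarrow> \<phi> (- u) = - \<phi> u"
  using hom_scale[of \<phi> N "- 1" u] by simp

lemma hom_mono:
  fixes u v :: "'a::topological_space \<Rightarrow>\<^sub>C real"
  assumes "\<phi> \<in> annihilating_homs N" "\<And>x. u x \<le> v x"
  shows "\<phi> u \<le> \<phi> v"
proof -
  have "babs (v - u) = v - u"
    using assms(2) by (intro bcontfun_eqI) simp
  then show ?thesis
    using hom_babs[OF assms(1), of "v - u"] by (simp add: hom_diff[OF assms(1)])
qed

lemma evaluation_in_lattice_homs: "(\<lambda>u. apply_bcontfun u x) \<in> lattice_homs"
  using norm_bounded[where x = x and 'b = real] by (auto simp: lattice_homs_def)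

lemma closed_lattice_homs:
  "closed (lattice_homs :: (('a::topological_space \<Rightarrow>\<^sub>C real) \<Rightarrow> real) set)"
  unfolding lattice_homs_def
  by (intro closed_Collect_conj closed_Collect_all closed_Collect_eq closed_Collect_le
      continuous_on_add continuous_on_mult continuous_on_rabs continuous_on_const
      continuous_on_product_coordinates)

text \<open>As in Banach--Alaoglu: contractivity places the homomorphisms in a product of compact
  intervals, compact by Tychonoff, and the defining conditions are closed for pointwise
  convergence.\<close>

lemma compact_lattice_homs:
  "compact (lattice_homs :: (('a::topological_space \<Rightarrow>\<^sub>C real) \<Rightarrow> real) set)"
proof -
  let ?P = "PiE UNIV (\<lambda>u :: 'a \<Rightarrow>\<^sub>C real. cball (0::real) (norm u))"
  have "compactin (product_topology (\<lambda>_. euclidean) UNIV) ?P"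
    unfolding compactin_PiE by simp
  then have "compact ?P"
    by (simp add: euclidean_product_topology)
  then have "compact (?P \<inter> lattice_homs)"
    by (rule compact_Int_closed[OF _ closed_lattice_homs])
  moreover have "?P \<inter> lattice_homs = lattice_homs"
    by (auto simp: lattice_homs_def)
  ultimately show ?thesis by simp
qed

lemma compact_annihilating_homs: "compact (annihilating_homs N)"
proof -
  have "annihilating_homs N = lattice_homs \<inter> (\<Inter>n\<in>N. {\<phi>. \<phi> n = 0})"
    by (auto simp: annihilating_homs_def)
  moreover have "closed (\<Inter>n\<in>N. {\<phi> :: ('a \<Rightarrow>\<^sub>C real) \<Rightarrow> real. \<phi> n = 0})"
    by (intro closed_INT ballI closed_Collect_eq continuous_on_const
        continuous_on_product_coordinates)
  ultimately show ?thesis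
    by (simp add: compact_Int_closed compact_lattice_homs)
qed

definition pos_part :: "('a::topological_space \<Rightarrow>\<^sub>C real) \<Rightarrow> ('a \<Rightarrow>\<^sub>C real)" where
  "pos_part u = (1/2) *\<^sub>R (u + babs u)"

lemma pos_part_apply [simp]: "pos_part u x = max 0 (u x)"
  by (simp add: pos_part_def max_def)

lemma pos_part_in_E_C: "u \<in> E\<^sub>C \<Longrightarrow> pos_part u \<in> E\<^sub>C"
  unfolding pos_part_def
  by (intro subspace_scale subspace_add subspace_E_C babs_in_E_C)

section \<open>Homomorphisms that annihilate a closed ideal\<close>

locale closed_lattice_ideal =
  fixes N :: "('a::real_normed_vector dual_ball \<Rightarrow>\<^sub>C real) set"
  assumes closed_N: "closed N" and ideal: "lattice_ideal N"
begin

abbreviation w :: "'a dual_ball \<Rightarrow>\<^sub>C real" where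
  "w \<equiv> J (cball 0 1)"

lemma w_in_E_C: "w \<in> E\<^sub>C"
  by (rule J_in_E_C[OF bounded_sets_ball])

lemma w_bounds: "0 \<le> w \<omega>" "w \<omega> \<le> 1"
  using functional[of \<omega>] by (simp_all add: J_ball)

lemma subspace_N: "subspace N" and N_subset_E_C: "N \<subseteq> E\<^sub>C"
  using ideal by (simp_all add: lattice_ideal_def)

lemma N_solid: "u \<in> E\<^sub>C \<Longrightarrow> v \<in> N \<Longrightarrow> (\<And>\<omega>. \<bar>u \<omega>\<bar> \<le> \<bar>v \<omega>\<bar>) \<Longrightarrow> u \<in> N"
  using ideal unfolding lattice_ideal_def by blast

lemma babs_in_N: "n \<in> N \<Longrightarrow> babs n \<in> N"
  using N_subset_E_C by (intro N_solid[of "babs n" n] babs_in_E_C) auto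

lemma shift_in_E_C: "u \<in> E\<^sub>C \<Longrightarrow> u - c *\<^sub>R w \<in> E\<^sub>C"
  by (intro subspace_diff subspace_scale subspace_E_C w_in_E_C)

text \<open>If \<open>(u - c w)\<^sup>+\<close> is not in the ideal, then for every \<open>m \<in> N\<close> there is a point \<open>\<omega>\<close> of the unit
  sphere with \<open>u \<omega> \<ge> c\<close> and \<open>m \<omega> \<le> 1\<close>: otherwise a multiple of \<open>m\<close> dominates \<open>(u - c w)\<^sup>+\<close>. A
  cluster point of the evaluations at these points annihilates \<open>N\<close> and is at least \<open>c\<close> at \<open>u\<close>.\<close>

lemma pos_part_in_N:
  assumes u: "u \<in> E\<^sub>C" and less: "\<And>\<phi>. \<phi> \<in> annihilating_homs N \<Longrightarrow> \<phi> u < c"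
  shows "pos_part (u - c *\<^sub>R w) \<in> N"
proof (rule ccontr)
  let ?p = "pos_part (u - c *\<^sub>R w)"
  assume notin: "?p \<notin> N"
  have point: "\<exists>\<omega>. c \<le> u \<omega> \<and> m \<omega> \<le> 1" if m: "m \<in> N" "\<And>\<omega>. 0 \<le> m \<omega>" for m
  proof (rule ccontr)
    assume contra: "\<nexists>\<omega>. c \<le> u \<omega> \<and> m \<omega> \<le> 1"
    \<comment> \<open>On the sphere m exceeds 1 wherever u is at least c, and \<open>?p\<close>
      vanishes elsewhere; so the norm of \<open>?p\<close> is a sufficient multiple.\<close>
    define M where "M = norm ?p"
    have "(?p - M *\<^sub>R m) \<omega> \<le> 0" for \<omega>
    proof (rule E_C_nonpos_of_sphere)
      show "?p - M *\<^sub>R m \<in> E\<^sub>C"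
        using m(1) N_subset_E_C
        by (intro subspace_diff[OF subspace_E_C] subspace_scale[OF subspace_E_C] pos_part_in_E_C
            shift_in_E_C u) auto
      fix \<omega> :: "'a dual_ball" assume sphere: "norm (functional \<omega>) = 1"
      have M: "0 \<le> M" "?p \<omega> \<le> M" using norm_bounded[of ?p \<omega>] by (auto simp: M_def)
      show "(?p - M *\<^sub>R m) \<omega> \<le> 0"
      proof (cases "c \<le> u \<omega>")
        case True
        then have "1 \<le> m \<omega>" using contra by (meson linear)
        then have "M * 1 \<le> M * m \<omega>" using M(1) by (rule mult_left_mono)
        then show ?thesis using M(2) by simp
      next
        case False
        then have "?p \<omega> = 0" using sphere by (simp add: J_ball)
        then show ?thesis using M(1) m(2)[of \<omega>] by simp
      qed
    qed
    then have "?p \<in> N"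
      using m by (intro N_solid[OF pos_part_in_E_C[OF shift_in_E_C[OF u]], of "M *\<^sub>R m"]
          subspace_scale[OF subspace_N]) (auto intro: order_trans[OF _ abs_ge_self])
    then show False using notin by simp
  qed
  define C where "C n = {\<phi> :: ('a dual_ball \<Rightarrow>\<^sub>C real) \<Rightarrow> real. \<bar>\<phi> n\<bar> \<le> 1}" for n
  define S where "S = lattice_homs \<inter> {\<phi> :: ('a dual_ball \<Rightarrow>\<^sub>C real) \<Rightarrow> real. c \<le> \<phi> u}"
  have "S \<inter> \<Inter>(C ` N) \<noteq> {}"
  proof (rule compact_imp_fip)
    have "closed {\<phi> :: ('a dual_ball \<Rightarrow>\<^sub>C real) \<Rightarrow> real. c \<le> \<phi> u}"
      by (intro closed_Collect_le continuous_on_const continuous_on_product_coordinates)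
    then show "compact S"
      unfolding S_def by (intro compact_Int_closed compact_lattice_homs)
    show "closed X" if "X \<in> C ` N" for X
      using that by (auto simp: C_def intro!: closed_Collect_le continuous_on_rabs continuous_on_const
          continuous_on_product_coordinates)
    fix F assume "finite F" "F \<subseteq> C ` N"
    then obtain I where I: "finite I" "I \<subseteq> N" "F = C ` I"
      by (auto dest: finite_subset_image)
    \<comment> \<open>One element of the ideal dominates all finitely many \<bar>n\<bar>, so a
      single point meets all the constraints at once.\<close>
    let ?m = "\<Sum>n\<in>I. babs n"
    have m: "?m \<omega> = (\<Sum>n\<in>I. \<bar>apply_bcontfun n \<omega>\<bar>)" for \<omega>
      by (simp add: apply_bcontfun_sum)
    obtain \<omega> where \<omega>: "c \<le> u \<omega>" "(\<Sum>n\<in>I. \<bar>apply_bcontfun n \<omega>\<bar>) \<le> 1"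
      using point[of ?m] I(2) by (auto simp: m sum_nonneg intro!: subspace_sum[OF subspace_N] babs_in_N)
    have "\<bar>apply_bcontfun n \<omega>\<bar> \<le> 1" if "n \<in> I" for n
      using member_le_sum[OF that, of "\<lambda>n. \<bar>apply_bcontfun n \<omega>\<bar>"] I(1) \<omega>(2) by simp
    then have "(\<lambda>u. apply_bcontfun u \<omega>) \<in> S \<inter> \<Inter>F"
      using \<omega>(1) by (auto simp: S_def I(3) C_def evaluation_in_lattice_homs)
    then show "S \<inter> \<Inter>F \<noteq> {}" by blast
  qed
  then obtain \<phi> where \<phi>: "\<phi> \<in> lattice_homs" "c \<le> \<phi> u" "\<And>n. n \<in> N \<Longrightarrow> \<bar>\<phi> n\<bar> \<le> 1"
    by (auto simp: S_def C_def)
  \<comment> \<open>N is a subspace, so a bound by 1 on all of it forces zero: otherwise n could be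
    rescaled to the value 2.\<close>
  have "\<phi> n = 0" if n: "n \<in> N" for n
  proof (rule ccontr)
    assume "\<phi> n \<noteq> 0"
    moreover have "\<phi> ((2 / \<phi> n) *\<^sub>R n) = (2 / \<phi> n) * \<phi> n"
      using \<phi>(1) by (simp add: lattice_homs_def)
    ultimately show False
      using \<phi>(3)[OF subspace_scale[OF subspace_N n, of "2 / \<phi> n"]] by simp
  qed
  then have "\<phi> \<in> annihilating_homs N"
    using \<phi>(1) by (simp add: annihilating_homs_def)
  then show False using less \<phi>(2) by fastforce
qed

section \<open>The Gelfand transform of the quotient\<close>

text \<open>Any representative of the coset gives the same value, since the homomorphisms vanish on
  N; the value 0 elsewhere is the normalisation required by \<open>C_space\<close>.\<close>

definition Gelfand :: "('a dual_ball \<Rightarrow>\<^sub>C real) set \<Rightarrow> (('a dual_ball \<Rightarrow>\<^sub>C real) \<Rightarrow> real) \<Rightarrow> real" where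
  "Gelfand U = (\<lambda>\<phi>. if \<phi> \<in> annihilating_homs N then \<phi> (SOME u. u \<in> U) else 0)"

lemma Gelfand_coset:
  "Gelfand (u +o N) = (\<lambda>\<phi>. if \<phi> \<in> annihilating_homs N then \<phi> u else 0)"
proof -
  have "u + 0 \<in> u +o N" by (intro set_plus_intro2 subspace_0[OF subspace_N])
  then have "(SOME v. v \<in> u +o N) \<in> u +o N" by (rule someI)
  then obtain n where n: "n \<in> N" "(SOME v. v \<in> u +o N) = u + n"
    by (auto simp: elt_set_plus_def)
  then show ?thesis
    by (auto simp: Gelfand_def hom_add annihilating_homs_zero)
qed

lemma Gelfand_in_C_space: "Gelfand (u +o N) \<in> C_space (top_of_set (annihilating_homs N))"
proof -
  have "continuous_on (annihilating_homs N) (\<lambda>\<phi>. \<phi> u)"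
    by (rule continuous_on_subset[OF continuous_on_product_coordinates subset_UNIV])
  then have "continuous_on (annihilating_homs N) (Gelfand (u +o N))"
    by (rule continuous_on_eq) (simp add: Gelfand_coset)
  then show ?thesis
    by (simp add: C_space_def Gelfand_coset)
qed

text \<open>Clip u to the interval from - c w to c w. The parts cut off above and below lie in the
  ideal, so the clipped function represents the same coset, and its norm is at most c because 0
  \<le> w \<le> 1.\<close>

lemma coset_norm_le:
  assumes u: "u \<in> E\<^sub>C" and less: "\<And>\<phi>. \<phi> \<in> annihilating_homs N \<Longrightarrow> \<bar>\<phi> u\<bar> < c" and c: "0 \<le> c"
  shows "coset_norm (u +o N) \<le> c"
proof -
  let ?p = "pos_part (u - c *\<^sub>R w)" and ?q = "pos_part (- u - c *\<^sub>R w)"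
  have "- u \<in> E\<^sub>C" by (rule subspace_neg[OF subspace_E_C u])
  then have "?p \<in> N" "?q \<in> N"
    using less by (auto intro!: pos_part_in_N u simp: hom_uminus abs_less_iff)
  then have "?q - ?p \<in> N" by (intro subspace_diff subspace_N)
  then have mem: "u + (?q - ?p) \<in> u +o N" by (rule set_plus_intro2)
  have "coset_norm (u +o N) \<le> norm (u + (?q - ?p))"
    unfolding coset_norm_def by (intro cINF_lower mem bdd_belowI2[where m = 0]) simp
  also have "\<dots> \<le> c"
  proof (rule norm_bound)
    fix \<omega>
    have "0 \<le> c * w \<omega>" "c * w \<omega> \<le> c * 1"
      using mult_left_mono[OF w_bounds(2)[of \<omega>] c] mult_nonneg_nonneg[OF c w_bounds(1)[of \<omega>]]
      by auto
    then show "norm ((u + (?q - ?p)) \<omega>) \<le> c" by (auto simp: max_def)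
  qed
  finally show ?thesis .
qed

lemma C_norm_Gelfand:
  assumes u: "u \<in> E\<^sub>C"
  shows "C_norm (top_of_set (annihilating_homs N)) (Gelfand (u +o N)) = coset_norm (u +o N)"
proof -
  let ?A = "insert 0 ((\<lambda>\<phi>. \<bar>\<phi> u\<bar>) ` annihilating_homs N)"
  have eq: "C_norm (top_of_set (annihilating_homs N)) (Gelfand (u +o N)) = Sup ?A"
    by (simp add: C_norm_def Gelfand_coset)
  have upper: "x \<le> Sup ?A" if "x \<in> ?A" for x
    by (intro cSup_upper that bdd_aboveI[where M = "norm u"]) (auto simp: hom_le_norm)
  have "Sup ?A \<le> coset_norm (u +o N)"
    unfolding coset_norm_def
  proof (intro cSup_least cINF_greatest)
    show "u +o N \<noteq> {}"
      using set_plus_intro2[OF subspace_0[OF subspace_N]] by blast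
    fix x v assume "x \<in> ?A" "v \<in> u +o N"
    then obtain n where n: "n \<in> N" "v = u + n" by (auto simp: elt_set_plus_def)
    have "\<bar>\<phi> u\<bar> \<le> norm v" if "\<phi> \<in> annihilating_homs N" for \<phi>
      using hom_le_norm[OF that, of v] n by (simp add: hom_add[OF that] annihilating_homs_zero[OF that])
    with \<open>x \<in> ?A\<close> show "x \<le> norm v" by auto
  qed simp
  \<comment> \<open>The slack e supplies the strict inequality that \<open>coset_norm_le\<close>
    requires.\<close>
  moreover have "coset_norm (u +o N) \<le> Sup ?A"
  proof (rule field_le_epsilon)
    fix e :: real assume e: "0 < e"
    show "coset_norm (u +o N) \<le> Sup ?A + e"
    proof (rule coset_norm_le[OF u])
      show "\<bar>\<phi> u\<bar> < Sup ?A + e" if "\<phi> \<in> annihilating_homs N" for \<phi>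
        using upper[of "\<bar>\<phi> u\<bar>"] that e by auto
      show "0 \<le> Sup ?A + e" using upper[of 0] e by auto
    qed
  qed
  ultimately show ?thesis by (simp add: eq)
qed

text \<open>For the converse, the positive part of u - v is a norm limit of the truncations
  \<open>?p\<close>, which lie in N; N being closed, it lies in N itself. Adding it to v gives a
  representative above u.\<close>

lemma coset_le_iff_Gelfand:
  assumes u: "u \<in> E\<^sub>C" and v: "v \<in> E\<^sub>C"
  shows "coset_le (u +o N) (v +o N) \<longleftrightarrow> Gelfand (u +o N) \<le> Gelfand (v +o N)"
proof
  assume "coset_le (u +o N) (v +o N)"
  then obtain n m where nm: "n \<in> N" "m \<in> N" "\<And>\<omega>. (u + n) \<omega> \<le> (v + m) \<omega>"
    unfolding coset_le_def elt_set_plus_def by blast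
  have "\<phi> u \<le> \<phi> v" if \<phi>: "\<phi> \<in> annihilating_homs N" for \<phi>
    using hom_mono[OF \<phi> nm(3)] nm(1,2) by (simp only: hom_add[OF \<phi>] annihilating_homs_zero[OF \<phi>])
  then show "Gelfand (u +o N) \<le> Gelfand (v +o N)"
    by (simp add: Gelfand_coset le_fun_def)
next
  assume le: "Gelfand (u +o N) \<le> Gelfand (v +o N)"
  have \<phi>: "\<phi> (u - v) \<le> 0" if "\<phi> \<in> annihilating_homs N" for \<phi>
    using le_funD[OF le, of \<phi>] that by (simp add: Gelfand_coset hom_diff)
  have uv: "u - v \<in> E\<^sub>C" by (rule subspace_diff[OF subspace_E_C u v])
  have "pos_part (u - v) \<in> closure N"
    unfolding closure_approachable
  proof (intro allI impI)
    fix e :: real assume e: "0 < e"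
    let ?p = "pos_part (u - v - (e / 2) *\<^sub>R w)"
    have "\<phi> (u - v) < e / 2" if "\<phi> \<in> annihilating_homs N" for \<phi>
      using \<phi>[OF that] e by simp
    then have "?p \<in> N" by (rule pos_part_in_N[OF uv])
    moreover have "dist ?p (pos_part (u - v)) \<le> e / 2"
    proof (rule dist_bound)
      fix \<omega>
      have "0 \<le> e / 2 * w \<omega>" "e / 2 * w \<omega> \<le> e / 2 * 1"
        using e w_bounds[of \<omega>] by (auto intro!: mult_left_mono[of _ 1 "e / 2", simplified])
      then show "dist (?p \<omega>) (pos_part (u - v) \<omega>) \<le> e / 2"
        by (auto simp: dist_real_def max_def)
    qed
    ultimately show "\<exists>n\<in>N. dist n (pos_part (u - v)) < e"
      using e by (intro bexI[of _ ?p]) auto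
  qed
  then have "pos_part (u - v) \<in> N" using closed_N by simp
  then have "v + pos_part (u - v) \<in> v +o N" by (rule set_plus_intro2)
  moreover have "u + 0 \<in> u +o N" by (intro set_plus_intro2 subspace_0[OF subspace_N])
  moreover have "(u + 0) \<omega> \<le> (v + pos_part (u - v)) \<omega>" for \<omega> by simp
  ultimately show "coset_le (u +o N) (v +o N)"
    unfolding coset_le_def by blast
qed

text \<open>Maximum and minimum are (a + b \<plusminus> \<bar>a - b\<bar>) / 2, and the
  homomorphisms preserve sums, multiples and absolute values.\<close>

lemma Gelfand_sup_inf:
  assumes u: "u \<in> E\<^sub>C" and v: "v \<in> E\<^sub>C"
  shows "sup (Gelfand (u +o N)) (Gelfand (v +o N)) \<in> Gelfand ` quotient_space N"
    and "inf (Gelfand (u +o N)) (Gelfand (v +o N)) \<in> Gelfand ` quotient_space N"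
proof -
  let ?s = "(1/2) *\<^sub>R (u + v + babs (u - v))" and ?i = "(1/2) *\<^sub>R (u + v - babs (u - v))"
  note E = subspace_scale[OF subspace_E_C] subspace_add[OF subspace_E_C]
    subspace_diff[OF subspace_E_C] babs_in_E_C u v
  have mem: "Gelfand (x +o N) \<in> Gelfand ` quotient_space N" if "x \<in> E\<^sub>C" for x
    using that by (simp add: quotient_space_def)
  have "sup (Gelfand (u +o N)) (Gelfand (v +o N)) = Gelfand (?s +o N)"
    by (rule ext) (auto simp: Gelfand_coset hom_add hom_diff hom_scale hom_babs sup_max max_def abs_if)
  moreover have "?s \<in> E\<^sub>C" by (intro E)
  ultimately show "sup (Gelfand (u +o N)) (Gelfand (v +o N)) \<in> Gelfand ` quotient_space N"
    using mem by metis
  have "inf (Gelfand (u +o N)) (Gelfand (v +o N)) = Gelfand (?i +o N)"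
    by (rule ext) (auto simp: Gelfand_coset hom_add hom_diff hom_scale hom_babs inf_min min_def abs_if)
  moreover have "?i \<in> E\<^sub>C" by (intro E)
  ultimately show "inf (Gelfand (u +o N)) (Gelfand (v +o N)) \<in> Gelfand ` quotient_space N"
    using mem by metis
qed

lemma Gelfand_order_isometry:
  "order_isometry_into_C N (top_of_set (annihilating_homs N)) Gelfand"
  unfolding order_isometry_into_C_def quotient_space_def ball_simps image_subset_iff
proof (intro conjI ballI allI)
  fix u v :: "'a dual_ball \<Rightarrow>\<^sub>C real" assume u: "u \<in> E\<^sub>C" and v: "v \<in> E\<^sub>C"
  show "Gelfand ((u + v) +o N) = (\<lambda>x. Gelfand (u +o N) x + Gelfand (v +o N) x)"
    by (auto simp: Gelfand_coset hom_add)
  show "Gelfand ((c *\<^sub>R u) +o N) = (\<lambda>x. c * Gelfand (u +o N) x)" for c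
    by (auto simp: Gelfand_coset hom_scale)
  show "coset_le (u +o N) (v +o N) \<longleftrightarrow> Gelfand (u +o N) \<le> Gelfand (v +o N)"
    by (rule coset_le_iff_Gelfand[OF u v])
  show "sup (Gelfand (u +o N)) (Gelfand (v +o N)) \<in> Gelfand ` (\<lambda>u. u +o N) ` E\<^sub>C"
    "inf (Gelfand (u +o N)) (Gelfand (v +o N)) \<in> Gelfand ` (\<lambda>u. u +o N) ` E\<^sub>C"
    using Gelfand_sup_inf[OF u v] by (simp_all add: quotient_space_def)
qed (auto simp: Gelfand_in_C_space C_norm_Gelfand)

end

lemma compact_Hausdorff_annihilating_homs:
  "compact_space (top_of_set (annihilating_homs N))"
  "Hausdorff_space (top_of_set (annihilating_homs N))"
proof -
  show "compact_space (top_of_set (annihilating_homs N))"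
    by (intro compact_space_subtopology) (simp add: compact_annihilating_homs)
  have "Hausdorff_space (product_topology (\<lambda>u :: 'a \<Rightarrow>\<^sub>C real. euclideanreal) UNIV)"
    by (simp add: Hausdorff_space_product_topology)
  then show "Hausdorff_space (top_of_set (annihilating_homs N))"
    by (simp add: euclidean_product_topology Hausdorff_space_subtopology)
qed

text \<open>K and T are not unique, so the factorisation is asserted for every admissible pair, with
  N either \<open>E\<^sub>K\<close> or \<open>E\<^sub>K_ideal\<close>; existence of a pair is the
  first conjunct. It concerns the generated closed ideal, which is \<open>E\<^sub>K\<close> itself
  whenever \<open>E\<^sub>K\<close> is an ideal.\<close>

theorem theorem6p5:
  fixes \<D> :: "'a::banach set set"
  assumes infinite_dim: "\<nexists>S::'a set. finite S \<and> span S = UNIV"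
    and fundamental: "fundamental_subsemigroup \<D>"
  shows
    "(\<exists>(K :: (('a dual_ball \<Rightarrow>\<^sub>C real) \<Rightarrow> real) topology)
        (T :: ('a dual_ball \<Rightarrow>\<^sub>C real) set \<Rightarrow> (('a dual_ball \<Rightarrow>\<^sub>C real) \<Rightarrow> real) \<Rightarrow> real).
        compact_space K \<and> Hausdorff_space K \<and> order_isometry_into_C E\<^sub>K_ideal K T) \<and>
     (\<forall>N \<in> {E\<^sub>K, E\<^sub>K_ideal}. \<forall>(K :: 'k topology) T.
        compact_space K \<and> Hausdorff_space K \<and> order_isometry_into_C N K T \<longrightarrow>
        (let \<T> = TQJ N T; V = \<T> ` bounded_sets; ball = cball (0::'a) 1 in
          cone_in_C_pos K V \<and>
          (\<forall>\<mu>. convex_measure \<D> \<mu> \<longrightarrow>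
            (\<exists>F :: ('k \<Rightarrow> real) \<Rightarrow> real.
              (\<forall>B\<in>bounded_sets. \<mu> B = F (\<T> B)) \<and>
              (\<forall>f\<in>V. 0 \<le> F f) \<and>
              (\<forall>f\<in>V. \<forall>g\<in>V. \<forall>t. 0 \<le> t \<and> t \<le> 1 \<longrightarrow>
                 F (\<lambda>x. t * f x + (1 - t) * g x) \<le> t * F f + (1 - t) * F g) \<and>
              (\<forall>f\<in>V. \<forall>g\<in>V. f \<le> g \<longrightarrow> F f \<le> F g) \<and>
              (\<forall>r\<ge>0. \<forall>f\<in>V. C_norm K f \<le> r \<longrightarrow> \<bar>F f\<bar> \<le> F (\<lambda>x. r * \<T> ball x)) \<and>
              (\<forall>r\<ge>0.
                 F (\<lambda>x. (1 + r) * \<T> ball x) = \<mu> ((1 + r) \<cdot> ball) \<and>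
                 (\<forall>f\<in>V. \<forall>g\<in>V. C_norm K f \<le> r \<and> C_norm K g \<le> r \<longrightarrow>
                    \<bar>F f - F g\<bar> \<le> F (\<lambda>x. (1 + r) * \<T> ball x) * C_norm K (\<lambda>x. f x - g x))) \<and>
              (sublinear_measure \<D> \<mu> \<longrightarrow>
                 (\<forall>r\<ge>0. \<forall>f\<in>V. \<forall>g\<in>V. C_norm K f \<le> r \<and> C_norm K g \<le> r \<longrightarrow>
                    \<bar>F f - F g\<bar> \<le> \<mu> ball * C_norm K (\<lambda>x. f x - g x)))))))"
proof (intro conjI ballI allI impI)
  interpret closed_lattice_ideal "E\<^sub>K_ideal :: ('a dual_ball \<Rightarrow>\<^sub>C real) set"
    by unfold_locales (rule closed_lattice_ideal_E_K_ideal[OF refl])+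
  show "\<exists>(K :: (('a dual_ball \<Rightarrow>\<^sub>C real) \<Rightarrow> real) topology)
      (T :: ('a dual_ball \<Rightarrow>\<^sub>C real) set \<Rightarrow> (('a dual_ball \<Rightarrow>\<^sub>C real) \<Rightarrow> real) \<Rightarrow> real).
      compact_space K \<and> Hausdorff_space K \<and> order_isometry_into_C E\<^sub>K_ideal K T"
    using compact_Hausdorff_annihilating_homs Gelfand_order_isometry by blast
next
  fix N :: "('a dual_ball \<Rightarrow>\<^sub>C real) set" and K :: "'k topology" and T
  assume N: "N \<in> {E\<^sub>K, E\<^sub>K_ideal}"
    and K: "compact_space K \<and> Hausdorff_space K \<and> order_isometry_into_C N K T"
  interpret quotient_isometry N K T
  proof
    show "E\<^sub>K \<subseteq> N" using N E_K_subset_E_K_ideal by auto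
    show "N \<subseteq> finitely_dominated"
      using N E_K_subset_finitely_dominated E_K_ideal_subset_finitely_dominated by auto
    show "order_isometry_into_C N K T" using K by simp
  qed
  have "nonproperty_quotient \<D> \<mu> N K T" if "convex_measure \<D> \<mu>" for \<mu>
    by (intro nonproperty_quotient.intro nonproperty.intro fundamental that quotient_isometry_axioms)
  from nonproperty_quotient.representing_function[OF this]
  show "let \<T> = TQJ N T; V = \<T> ` bounded_sets; ball = cball (0::'a) 1 in
    cone_in_C_pos K V \<and>
    (\<forall>\<mu>. convex_measure \<D> \<mu> \<longrightarrow>
      (\<exists>F :: ('k \<Rightarrow> real) \<Rightarrow> real.
        (\<forall>B\<in>bounded_sets. \<mu> B = F (\<T> B)) \<and>
        (\<forall>f\<in>V. 0 \<le> F f) \<and>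
        (\<forall>f\<in>V. \<forall>g\<in>V. \<forall>t. 0 \<le> t \<and> t \<le> 1 \<longrightarrow>
           F (\<lambda>x. t * f x + (1 - t) * g x) \<le> t * F f + (1 - t) * F g) \<and>
        (\<forall>f\<in>V. \<forall>g\<in>V. f \<le> g \<longrightarrow> F f \<le> F g) \<and>
        (\<forall>r\<ge>0. \<forall>f\<in>V. C_norm K f \<le> r \<longrightarrow> \<bar>F f\<bar> \<le> F (\<lambda>x. r * \<T> ball x)) \<and>
        (\<forall>r\<ge>0.
           F (\<lambda>x. (1 + r) * \<T> ball x) = \<mu> ((1 + r) \<cdot> ball) \<and>
           (\<forall>f\<in>V. \<forall>g\<in>V. C_norm K f \<le> r \<and> C_norm K g \<le> r \<longrightarrow>
              \<bar>F f - F g\<bar> \<le> F (\<lambda>x. (1 + r) * \<T> ball x) * C_norm K (\<lambda>x. f x - g x))) \<and>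
        (sublinear_measure \<D> \<mu> \<longrightarrow>
           (\<forall>r\<ge>0. \<forall>f\<in>V. \<forall>g\<in>V. C_norm K f \<le> r \<and> C_norm K g \<le> r \<longrightarrow>
              \<bar>F f - F g\<bar> \<le> \<mu> ball * C_norm K (\<lambda>x. f x - g x)))))"
    unfolding Let_def using cone_range by blast
qed

end
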